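(* Let $\mathbb{F}_q$ be a finite field with $q=p^m$ elements, $p$ prime, and let $c=q^3(q+1)(q^2+q+1)/6$. The number $\mathcal{N}(3,\mathbb{F}_q)$ of isomorphism classes of $3$-dimensional idempotent evolution algebras over $\mathbb{F}_q$ is as follows. If $p=2$: $$\mathcal{N}(3,\mathbb{F}_q)=\begin{cases} c+3+\frac{q^3}{2}+\frac{(q-1)^2}{3}, & 7\mid(q-1),\ 3\mid(q-1);\\ c+2+\frac{q^3}{2}+\frac{q^2-1}{3}, & 7\mid(q-1),\ 3\nmid(q-1);\\ c+1+\frac{q^3}{2}+\frac{(q-1)^2}{3}, & 7\nmid(q-1),\ 3\mid(q-1);\\ c+\frac{q^3}{2}+\frac{q^2-1}{3}, & 7\nmid(q-1),\ 3\nmid(q-1).\end{cases}$$ If $p=3$: $$\mathcal{N}(3,\mathbb{F}_q)=\begin{cases} c+2+\frac{q(q^2-1)}{2}+\frac{q^2}{3}, & 7\mid(q-1);\\ c+\frac{q(q^2-1)}{2}+\frac{q^2}{3}, & 7\nmid(q-1).\end{cases}$$ If $p>3$: $$\mathcal{N}(3,\mathbb{F}_q)=\begin{cases} c+3+\frac{q(q^2-1)}{2}+\frac{(q-1)^2}{3}, & 7\mid(q-1),\ 3\mid(q-1);\\ c+2+\frac{q(q^2-1)}{2}+\frac{q^2-1}{3}, & 7\mid(q-1),\ 3\nmid(q-1);\\ c+1+\frac{q(q^2-1)}{2}+\frac{(q-1)^2}{3}, & 7\nmid(q-1),\ 3\mid(q-1);\\ c+\frac{q(q^2-1)}{2}+\frac{q^2-1}{3},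 & 7\nmid(q-1),\ 3\nmid(q-1).\end{cases}$$
   Context: An $n$-dimensional evolution algebra over a field $\mathbb{F}$ is a (not necessarily associative) $\mathbb{F}$-algebra $\mathcal{E}$ having a vector space basis $e_1,\dots,e_n$ (a natural basis) such that $e_ie_j=0$ for $i\neq j$; its structure matrix is the $n\times n$ matrix $A$ with $(e_1^2,\dots,e_n^2)=(e_1,\dots,e_n)A$. It is called idempotent if $\mathcal{E}^2=\mathcal{E}$ (equivalently, $A$ is nonsingular). Isomorphism means isomorphism of $\mathbb{F}$-algebras. *)

theory Defs
  imports "HOL-Analysis.Cartesian_Space" "HOL-Computational_Algebra.Primes"
begin

locale nonassoc_algebra = vector_space scale
  for scale :: "'f::field \<Rightarrow> 'v::ab_group_add \<Rightarrow> 'v" +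
  fixes mult :: "'v \<Rightarrow> 'v \<Rightarrow> 'v"
  assumes linear_mult_left: "Vector_Spaces.linear scale scale (\<lambda>x. mult x y)"
    and linear_mult_right: "Vector_Spaces.linear scale scale (\<lambda>y. mult x y)"
begin

definition natural_basis :: "'v set \<Rightarrow> bool" where
  "natural_basis B \<longleftrightarrow>
     independent B \<and> span B = UNIV \<and> (\<forall>x\<in>B. \<forall>y\<in>B. x \<noteq> y \<longrightarrow> mult x y = 0)"

definition evolution_algebra :: "nat \<Rightarrow> bool" where
  "evolution_algebra n \<longleftrightarrow> (\<exists>B. natural_basis B \<and> finite B \<and> card B = n)"

text \<open>The square of the algebra is the linear span of all products.\<close>

definition idempotent :: bool where
  "idempotent \<longleftrightarrow> span {mult x y | x y. True} = UNIV"

end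

definition algebra_iso ::
  "('f::field \<Rightarrow> 'v::ab_group_add \<Rightarrow> 'v) \<Rightarrow> ('v \<Rightarrow> 'v \<Rightarrow> 'v) \<Rightarrow>
   ('f \<Rightarrow> 'w::ab_group_add \<Rightarrow> 'w) \<Rightarrow> ('w \<Rightarrow> 'w \<Rightarrow> 'w) \<Rightarrow> ('v \<Rightarrow> 'w) \<Rightarrow> bool" where
  "algebra_iso s1 m1 s2 m2 f \<longleftrightarrow>
     Vector_Spaces.linear s1 s2 f \<and> bij f \<and> (\<forall>x y. f (m1 x y) = m2 (f x) (f y))"

definition idempotent_evolution_algebra ::
  "('f::field \<Rightarrow> 'v::ab_group_add \<Rightarrow> 'v) \<Rightarrow> ('v \<Rightarrow> 'v \<Rightarrow> 'v) \<Rightarrow> nat \<Rightarrow> bool" where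
  "idempotent_evolution_algebra s m n \<longleftrightarrow>
     nonassoc_algebra s m \<and>
     nonassoc_algebra.evolution_algebra s m n \<and>
     nonassoc_algebra.idempotent s m"

text \<open>
  Isomorphism classes are counted among the multiplications on the coordinate space
  \<open>'f ^ 'n\<close>. Nothing is lost: by \<open>idempotent_evolution_algebra_on_coordinates\<close> below,
  an algebra of this kind on any vector space is isomorphic to one on \<open>'f ^ 'n\<close>.
\<close>

definition coord_algebras :: "('f::field ^ 'n \<Rightarrow> 'f ^ 'n \<Rightarrow> 'f ^ 'n) set" where
  "coord_algebras = {m. idempotent_evolution_algebra (*s) m CARD('n)}"

definition coord_iso ::
  "(('f::field ^ 'n \<Rightarrow> 'f ^ 'n \<Rightarrow> 'f ^ 'n) \<times> ('f ^ 'n \<Rightarrow> 'f ^ 'n \<Rightarrow> 'f ^ 'n)) set" where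
  "coord_iso = {(m1, m2). m1 \<in> coord_algebras \<and> m2 \<in> coord_algebras \<and>
                          (\<exists>f. algebra_iso (*s) m1 (*s) m2 f)}"

definition num_idempotent_evolution_algebras :: "'n::finite itself \<Rightarrow> 'f::field itself \<Rightarrow> nat" where
  "num_idempotent_evolution_algebras _ _ =
     card ((coord_algebras :: ('f ^ 'n \<Rightarrow> 'f ^ 'n \<Rightarrow> 'f ^ 'n) set) // coord_iso)"

lemma algebra_iso_inv:
  assumes "algebra_iso s1 m1 s2 m2 f"
  shows "algebra_iso s2 m2 s1 m1 (inv f)"
proof -
  have lin: "Vector_Spaces.linear s1 s2 f" and b: "bij f"
    and h: "\<And>x y. f (m1 x y) = m2 (f x) (f y)"
    using assms by (auto simp: algebra_iso_def)
  interpret Vector_Spaces.linear s1 s2 f by (rule lin)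
  have fi: "f (inv f y) = y" and "if": "inv f (f x) = x" for x y
    using b by (simp_all add: bij_is_surj surj_f_inv_f bij_is_inj inv_f_f)
  have "Vector_Spaces.linear s2 s1 (inv f)"
  proof
    show "inv f (x + y) = inv f x + inv f y" for x y
      by (metis fi "if" add)
    show "inv f (s2 c x) = s1 c (inv f x)" for c x
      by (metis fi "if" scale)
  qed
  moreover have "inv f (m2 x y) = m1 (inv f x) (inv f y)" for x y
    by (metis fi "if" h)
  ultimately show ?thesis
    using b by (simp add: algebra_iso_def bij_imp_bij_inv)
qed

lemma algebra_iso_trans:
  assumes "algebra_iso s1 m1 s2 m2 f" "algebra_iso s2 m2 s3 m3 g"
  shows "algebra_iso s1 m1 s3 m3 (g \<circ> f)"
  using assms by (auto simp: algebra_iso_def intro: bij_comp Vector_Spaces.linear_compose)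

lemma equiv_coord_iso: "equiv coord_algebras coord_iso"
proof (rule equivI)
  show "coord_iso \<subseteq> coord_algebras \<times> coord_algebras"
    by (auto simp: coord_iso_def)
  have "algebra_iso (*s) m (*s) m id" for m :: "'a ^ 'b \<Rightarrow> 'a ^ 'b \<Rightarrow> 'a ^ 'b"
    by (simp add: algebra_iso_def vec.linear_id)
  then show "refl_on coord_algebras (coord_iso :: (('a ^ 'b \<Rightarrow> _) \<times> _) set)"
    unfolding refl_on_def coord_iso_def by blast
  show "sym coord_iso"
    by (auto simp: sym_def coord_iso_def dest: algebra_iso_inv)
  show "trans coord_iso"
    by (auto simp: trans_def coord_iso_def dest: algebra_iso_trans)
qed

lemma idempotent_evolution_algebra_transfer:
  assumes iso: "algebra_iso s1 m1 s2 m2 f"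
    and alg: "idempotent_evolution_algebra s1 m1 n"
  shows "idempotent_evolution_algebra s2 m2 n"
proof -
  have lin: "Vector_Spaces.linear s1 s2 f" and b: "bij f"
    and h: "\<And>x y. f (m1 x y) = m2 (f x) (f y)"
    using iso by (auto simp: algebra_iso_def)
  interpret f: Vector_Spaces.linear s1 s2 f by (rule lin)
  interpret a: nonassoc_algebra s1 m1
    using alg by (simp add: idempotent_evolution_algebra_def)
  have lin': "Vector_Spaces.linear s2 s1 (inv f)"
    using algebra_iso_inv[OF iso] by (simp add: algebra_iso_def)
  have m2: "m2 x y = f (m1 (inv f x) (inv f y))" for x y
    using b by (simp add: h bij_is_surj surj_f_inv_f)
  have alg2: "nonassoc_algebra s2 m2"
  proof (intro nonassoc_algebra.intro nonassoc_algebra_axioms.intro)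
    show "vector_space s2" by (rule f.vs2.vector_space_axioms)
    show "Vector_Spaces.linear s2 s2 (\<lambda>x. m2 x y)" for y
      using Vector_Spaces.linear_compose[OF
          Vector_Spaces.linear_compose[OF lin' a.linear_mult_left] lin]
      by (simp add: m2 o_def)
    show "Vector_Spaces.linear s2 s2 (\<lambda>y. m2 x y)" for x
      using Vector_Spaces.linear_compose[OF
          Vector_Spaces.linear_compose[OF lin' a.linear_mult_right] lin]
      by (simp add: m2 o_def)
  qed
  interpret c: nonassoc_algebra s2 m2 by (rule alg2)
  obtain B where B: "a.natural_basis B" "finite B" "card B = n"
    using alg by (auto simp: idempotent_evolution_algebra_def a.evolution_algebra_def)
  have inj: "inj_on f A" for A
    using b by (meson bij_is_inj inj_on_subset subset_UNIV)
  have "c.natural_basis (f ` B)"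
    unfolding c.natural_basis_def
  proof (intro conjI)
    show "f.vs2.independent (f ` B)"
      using B inj f.independent_injective_image[of B] by (simp add: a.natural_basis_def)
    show "f.vs2.span (f ` B) = UNIV"
      using B b by (simp add: a.natural_basis_def f.span_image bij_is_surj)
    have "m2 (f x) (f y) = 0" if "x \<in> B" "y \<in> B" "f x \<noteq> f y" for x y
    proof -
      have "m1 x y = 0" using B that by (cases "x = y") (auto simp: a.natural_basis_def)
      then show ?thesis using h[of x y] by (simp add: f.zero)
    qed
    then show "\<forall>x\<in>f ` B. \<forall>y\<in>f ` B. x \<noteq> y \<longrightarrow> m2 x y = 0" by blast
  qed
  then have "c.evolution_algebra n"
    using B unfolding c.evolution_algebra_def
    by (intro exI[of _ "f ` B"]) (simp add: card_image[OF inj])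
  moreover have "f ` {m1 x y | x y. True} = {m2 x y | x y. True}"
  proof (intro equalityI subsetI)
    fix z assume "z \<in> f ` {m1 x y | x y. True}"
    then obtain x y where "z = m2 (f x) (f y)" by (auto simp: h)
    then show "z \<in> {m2 x y | x y. True}" by blast
  next
    fix z assume "z \<in> {m2 x y | x y. True}"
    then obtain x y where "z = f (m1 (inv f x) (inv f y))" unfolding m2 by blast
    then show "z \<in> f ` {m1 x y | x y. True}" by blast
  qed
  then have "f.vs2.span {m2 x y | x y. True} = f ` f.vs1.span {m1 x y | x y. True}"
    by (simp flip: f.span_image)
  then have "c.idempotent"
    using alg b by (simp add: c.idempotent_def idempotent_evolution_algebra_def
        a.idempotent_def bij_is_surj)
  ultimately show ?thesis
    using alg2 by (simp add: idempotent_evolution_algebra_def)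
qed

lemma idempotent_evolution_algebra_on_coordinates:
  fixes s :: "'f::field \<Rightarrow> 'v::ab_group_add \<Rightarrow> 'v"
  assumes alg: "idempotent_evolution_algebra s m0 CARD('n::finite)"
  obtains m :: "'f ^ 'n \<Rightarrow> 'f ^ 'n \<Rightarrow> 'f ^ 'n" and f
  where "m \<in> coord_algebras" "algebra_iso s m0 (*s) m f"
proof -
  interpret a: nonassoc_algebra s m0
    using alg by (simp add: idempotent_evolution_algebra_def)
  obtain B where B: "a.natural_basis B" "finite B" "card B = CARD('n)"
    using alg by (auto simp: idempotent_evolution_algebra_def a.evolution_algebra_def)
  obtain e where e: "bij_betw e (UNIV :: 'n set) B"
    using B by (metis finite finite_same_card_bij)
  have indep: "a.independent B" and span: "a.span B = UNIV"
    using B by (auto simp: a.natural_basis_def)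
  define g where "g v = (\<Sum>i\<in>UNIV. s (v $ i) (e i))" for v :: "'f ^ 'n"
  have ling: "Vector_Spaces.linear (*s) s g"
  proof
    show "g (x + y) = g x + g y" for x y
      by (simp add: g_def a.scale_left_distrib sum.distrib)
    show "g (c *s x) = s c (g x)" for c x
      by (simp add: g_def a.scale_sum_right)
  qed
  have ie: "inj e" and re: "range e = B"
    using e by (auto simp: bij_betw_def)
  have g_eq: "g v = (\<Sum>b\<in>B. s (v $ inv e b) b)" for v
    unfolding g_def re[symmetric] using ie by (simp add: sum.reindex)
  have "inj g"
  proof -
    have "v = 0" if "g v = 0" for v
    proof -
      have "v $ inv e b = 0" if b: "b \<in> B" for b
        using a.independentD[OF indep \<open>finite B\<close> subset_refl _ b] \<open>g v = 0\<close>
        by (simp add: g_eq)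
      then have "v $ i = 0" for i
        using ie re by (metis inv_f_f rangeI)
      then show ?thesis by (simp add: vec_eq_iff)
    qed
    then show ?thesis
      using module_hom.inj_iff_eq_0[OF Vector_Spaces.linear.axioms(3)[OF ling]] by blast
  qed
  moreover have "surj g"
  proof -
    have "\<exists>v. y = g v" for y
    proof -
      have "y \<in> a.span B" using span by simp
      then obtain u where "y = (\<Sum>b\<in>B. s (u b) b)"
        by (auto simp: a.span_finite[OF \<open>finite B\<close>])
      then have "y = g (\<chi> i. u (e i))"
        unfolding g_def re[symmetric] using ie by (simp add: sum.reindex)
      then show ?thesis ..
    qed
    then show ?thesis by (auto simp: surj_def)
  qed
  ultimately have bg: "bij g" by (simp add: bij_def)
  define m where "m x y = inv g (m0 (g x) (g y))" for x y
  have "algebra_iso (*s) m s m0 g"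
    using ling bg by (simp add: algebra_iso_def m_def bij_is_surj surj_f_inv_f)
  then have iso: "algebra_iso s m0 (*s) m (inv g)"
    by (rule algebra_iso_inv)
  moreover have "m \<in> coord_algebras"
    using idempotent_evolution_algebra_transfer[OF iso alg] by (simp add: coord_algebras_def)
  ultimately show thesis using that by blast
qed

end

theory Submission
  imports Defs
    "HOL-Analysis.Determinants"
    "HOL-Computational_Algebra.Polynomial"
    "HOL-Number_Theory.Residues"
    "HOL-Algebra.Group_Action"
begin

text \<open>
  An idempotent evolution algebra has, up to order and scaling, only one natural basis: for an
  isomorphism \<open>f\<close>, the relation \<open>e\<^sub>i e\<^sub>j = 0\<close> forces \<open>f e\<^sub>i\<close> and \<open>f e\<^sub>j\<close> to have disjoint supports, so \<open>f\<close> is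
  a monomial map (\<open>algebra_iso_imp_monomial_act\<close>). Isomorphism classes are therefore the orbits
  of the monomial group, of order \<open>6 (q - 1)\<^sup>3\<close>, on nonsingular \<open>3 \<times> 3\<close> structure matrices, where the element
  with coefficients \<open>a\<close> and permutation \<open>\<sigma>\<close> sends \<open>A\<close> to the matrix with entries
  \<open>a\<^sub>k A\<^sub>\<sigma>\<^sub>(\<^sub>k\<^sub>)\<^sub>,\<^sub>\<sigma>\<^sub>(\<^sub>l\<^sub>) / a\<^sub>l\<^sup>2\<close> (\<open>card_isomorphism_classes_eq_orbits\<close>). Burnside's lemma
  reduces the count to fixed matrices, and these depend on the cycle type of \<open>\<sigma>\<close>.

  For \<open>\<sigma> = id\<close> and \<open>a = 1\<close> all nonsingular matrices are fixed; they account for the term \<open>c\<close>. For \<open>\<sigma> = id\<close>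
  and \<open>a \<noteq> 1\<close> a fixed matrix is supported on a permutation that realises squaring on the coefficients
  (\<open>card_fixed_matrices_id\<close>); along a transposition this needs a nontrivial cube root of unity, along a three-cycle a nontrivial
  seventh root. This yields the summand 1 for \<open>3 dvd q - 1\<close> and the summand 2 for \<open>7 dvd q - 1\<close>.

  For a transposition \<open>\<sigma>\<close>, only coefficients that can be scaled to 1 admit nonsingular fixed matrices
  (\<open>card_fixed_matrices_transposition\<close>), and then these are the swap-invariant matrices, whose
  determinant is \<open>(x - y) ((x + y) z - 2 u v)\<close>. Counting its nonzeros (\<open>card_swap_invariant\<close>) gives
  \<open>q\<^sup>3 / 2\<close> in characteristic 2 and \<open>q (q\<^sup>2 - 1) / 2\<close> otherwise. For a three-cycle the fixed
  matrices are circulant after scaling (\<open>card_fixed_matrices_cycle\<close>). Their determinant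
  \<open>x\<^sup>3 + y\<^sup>3 + z\<^sup>3 - 3 x y z\<close> is a cube in characteristic 3; otherwise it is \<open>x + y + z\<close> times a
  quadratic form that splits if and only if there are nontrivial cube roots of unity (\<open>card_circulant\<close>). This gives
  the last summand, in its three forms.
\<close>

section \<open>Evolution algebras with a prescribed structure matrix\<close>

text \<open>
  The algebra in which the unit vectors form a natural basis with structure matrix \<open>A\<close>:
  only the squares \<open>e\<^sub>i e\<^sub>i\<close> survive in the bilinear expansion of a product, and
  \<open>e\<^sub>i e\<^sub>i\<close> is column \<open>i\<close> of \<open>A\<close>.
\<close>

definition evolution_mult :: "'f::field ^ 'n ^ 'n \<Rightarrow> 'f ^ 'n \<Rightarrow> 'f ^ 'n \<Rightarrow> 'f ^ 'n" where
  "evolution_mult A x y = A *v (\<chi> i. x $ i * y $ i)"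

lemma matrix_vector_mult_axis:
  fixes A :: "'a::comm_semiring_1 ^ 'n ^ 'm"
  shows "A *v axis k 1 = column k A"
proof -
  have "(\<Sum>j\<in>UNIV. A $ i $ j * axis k 1 $ j) = (\<Sum>j\<in>UNIV. if j = k then A $ i $ j else 0)" for i
    by (intro sum.cong) (auto simp: axis_def)
  then show ?thesis by (simp add: vec_eq_iff matrix_vector_mult_def column_def)
qed

lemma evolution_mult_axis:
  "evolution_mult A (axis i 1) (axis j 1) = (if i = j then column i A else 0)"
proof -
  have "(\<chi> l. axis i 1 $ l * axis j 1 $ l) = (if i = j then axis i (1::'a) else 0)"
    by (auto simp: vec_eq_iff axis_def)
  then show ?thesis
    by (simp add: evolution_mult_def matrix_vector_mult_axis)
qed

lemma nonassoc_algebra_evolution_mult: "nonassoc_algebra (*s) (evolution_mult A)"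
proof (intro nonassoc_algebra.intro nonassoc_algebra_axioms.intro)
  show "vector_space ((*s) :: 'a \<Rightarrow> 'a ^ 'b \<Rightarrow> 'a ^ 'b)" by unfold_locales
  show "Vector_Spaces.linear (*s) (*s) (\<lambda>x. evolution_mult A x y)" for y
    unfolding evolution_mult_def matrix_vector_mult_def
    by unfold_locales (simp_all add: vec_eq_iff algebra_simps sum.distrib sum_distrib_left)
  show "Vector_Spaces.linear (*s) (*s) (\<lambda>y. evolution_mult A x y)" for x
    unfolding evolution_mult_def matrix_vector_mult_def
    by unfold_locales (simp_all add: vec_eq_iff algebra_simps sum.distrib sum_distrib_left)
qed

text \<open>
  Multiplying by the all-ones vector already gives \<open>A x\<close>, so the products fill exactly the
  column space of \<open>A\<close>; the algebra equals its square precisely when that space is everything.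
\<close>

lemma evolution_mult_in_coord_algebras_iff:
  fixes A :: "'f::field ^ 'n ^ 'n"
  shows "evolution_mult A \<in> coord_algebras \<longleftrightarrow> invertible A"
proof -
  interpret nonassoc_algebra "(*s)" "evolution_mult A"
    by (rule nonassoc_algebra_evolution_mult)
  have inj: "inj (\<lambda>i. axis i 1 :: 'f ^ 'n)"
    by (auto intro!: injI simp: axis_eq_axis)
  have "natural_basis (cart_basis :: ('f ^ 'n) set)"
    unfolding natural_basis_def
    using vec.independent_Basis vec.span_Basis
    by (auto simp: cart_basis_def evolution_mult_axis)
  moreover have "card (cart_basis :: ('f ^ 'n) set) = CARD('n)"
    using card_image[OF inj] by (simp add: cart_basis_def full_SetCompr_eq)
  ultimately have ev: "evolution_algebra CARD('n)"
    unfolding evolution_algebra_def using finite_cart_basis by blast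
  have "{evolution_mult A x y | x y. True} = range ((*v) A)"
  proof -
    have "A *v x = evolution_mult A x (\<chi> i. 1)" for x
      by (simp add: evolution_mult_def)
    then have "range ((*v) A) \<subseteq> {evolution_mult A x y | x y. True}" by blast
    then show ?thesis by (auto simp: evolution_mult_def)
  qed
  moreover have "vec.span (range ((*v) A)) = range ((*v) A)"
    using vec.subspace_image[OF vec.subspace_UNIV, of A] by (rule vec.span_eq_iff[THEN iffD2])
  ultimately have "idempotent \<longleftrightarrow> range ((*v) A) = UNIV"
    unfolding idempotent_def by argo
  then have "idempotent \<longleftrightarrow> invertible A"
    by (auto simp: invertible_right_inverse matrix_right_invertible_surjective)
  then show ?thesis
    using nonassoc_algebra_axioms ev
    by (simp add: coord_algebras_def idempotent_evolution_algebra_def)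
qed

text \<open>
  Taking coordinates with respect to a natural basis turns the multiplication into one for which the
  unit vectors annihilate each other, and such a multiplication is determined by the squares of
  the unit vectors.
\<close>

lemma coord_algebra_iso_evolution_mult:
  fixes m :: "'f::field ^ 'n \<Rightarrow> 'f ^ 'n \<Rightarrow> 'f ^ 'n"
  assumes m: "m \<in> coord_algebras"
  obtains A :: "'f ^ 'n ^ 'n" and f
  where "invertible A" "algebra_iso (*s) m (*s) (evolution_mult A) f"
proof -
  have alg: "idempotent_evolution_algebra (*s) m CARD('n)"
    using m by (simp add: coord_algebras_def)
  then interpret a: nonassoc_algebra "(*s)" m
    by (simp add: idempotent_evolution_algebra_def)
  obtain B where B: "a.natural_basis B" "finite B" "card B = CARD('n)"
    using alg by (auto simp: idempotent_evolution_algebra_def a.evolution_algebra_def)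
  obtain e where e: "bij_betw e (UNIV :: 'n set) B"
    using B by (metis finite finite_same_card_bij)
  have ie: "inj e" and re: "range e = B"
    using e by (auto simp: bij_betw_def)
  \<comment> \<open>The change of basis from the unit vectors to the natural basis.\<close>
  define P :: "'f ^ 'n ^ 'n" where "P = (\<chi> k i. e i $ k)"
  have col: "column i P = e i" for i by (simp add: P_def column_def)
  have "columns P = B" by (auto simp: columns_def col re[symmetric])
  then have "\<exists>R. P ** R = mat 1"
    using B by (simp add: matrix_right_invertible_span_columns a.natural_basis_def)
  then have invP: "invertible P" by (simp add: invertible_right_inverse)
  then have bP: "bij ((*v) P)" by (simp add: invertible_eq_bij)
  have P_axis: "P *v axis i 1 = e i" for i by (simp add: matrix_vector_mult_axis col)
  define m' where "m' x y = inv_into UNIV ((*v) P) (m (P *v x) (P *v y))" for x y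
  have "algebra_iso (*s) m' (*s) m ((*v) P)"
    using bP by (simp add: algebra_iso_def m'_def bij_is_surj surj_f_inv_f)
  then have iso: "algebra_iso (*s) m (*s) m' (inv_into UNIV ((*v) P))"
    by (rule algebra_iso_inv)
  then have alg': "idempotent_evolution_algebra (*s) m' CARD('n)"
    using alg by (rule idempotent_evolution_algebra_transfer)
  then interpret b: nonassoc_algebra "(*s)" m'
    by (simp add: idempotent_evolution_algebra_def)
  have inv0: "inv_into UNIV ((*v) P) 0 = 0"
    using bP by (metis bij_inv_eq_iff vec.zero)
  have orth: "m' (axis i 1) (axis j 1) = 0" if "i \<noteq> j" for i j
    using B(1) that re ie inv0
    by (auto simp: m'_def P_axis a.natural_basis_def inj_eq)
  define A :: "'f ^ 'n ^ 'n" where "A = (\<chi> k i. m' (axis i 1) (axis i 1) $ k)"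
  have m'_eq: "m' = evolution_mult A"
  proof (intro ext)
    fix x y :: "'f ^ 'n"
    have x: "m' x z = (\<Sum>i\<in>UNIV. x $ i *s m' (axis i 1) z)" for z
      by (subst basis_expansion[of x, symmetric], subst vec.linear_sum[OF b.linear_mult_left])
         (simp only: vec.linear_scale[OF b.linear_mult_left])
    have y: "m' z y = (\<Sum>j\<in>UNIV. y $ j *s m' z (axis j 1))" for z
      by (subst basis_expansion[of y, symmetric], subst vec.linear_sum[OF b.linear_mult_right])
         (simp only: vec.linear_scale[OF b.linear_mult_right])
    have "m' x y = (\<Sum>i\<in>UNIV. x $ i *s (\<Sum>j\<in>UNIV. y $ j *s m' (axis i 1) (axis j 1)))"
      unfolding x[of y] y[of "axis i 1" for i] ..
    also have "\<dots> = (\<Sum>i\<in>UNIV. \<Sum>j\<in>UNIV. (x $ i * y $ j) *s m' (axis i 1) (axis j 1))"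
      by (simp add: vec.scale_sum_right vector_smult_assoc)
    also have "\<dots> = (\<Sum>i\<in>UNIV. \<Sum>j\<in>UNIV. if i = j then (x $ i * y $ i) *s m' (axis i 1) (axis i 1) else 0)"
      by (intro sum.cong refl) (auto simp: orth)
    also have "\<dots> = (\<Sum>i\<in>UNIV. (x $ i * y $ i) *s m' (axis i 1) (axis i 1))"
      by simp
    also have "\<dots> = evolution_mult A x y"
      by (simp add: vec_eq_iff evolution_mult_def matrix_vector_mult_def A_def mult.commute)
    finally show "m' x y = evolution_mult A x y" .
  qed
  have "invertible A"
    using alg' evolution_mult_in_coord_algebras_iff[of A] by (simp add: coord_algebras_def m'_eq)
  then show thesis using iso unfolding m'_eq by (rule that)
qed

section \<open>Isomorphisms as monomial transformations\<close>

text \<open>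
  The pair \<open>(a, \<sigma>)\<close> stands for the linear map \<open>x \<mapsto> (a\<^sub>k x\<^sub>\<sigma>\<^sub>(\<^sub>k\<^sub>))\<^sub>k\<close>, and the group law is composition
  of these maps. Pairs, rather than matrices, keep the permutation available for sums over the group.
\<close>

definition monomial_group :: "(('n::finite \<Rightarrow> 'f::field) \<times> ('n \<Rightarrow> 'n)) monoid" where
  "monomial_group =
     \<lparr>carrier = {(a, \<sigma>). (\<forall>i. a i \<noteq> 0) \<and> bij \<sigma>},
      monoid.mult = (\<lambda>(b, \<tau>) (a, \<sigma>). (\<lambda>k. b k * a (\<tau> k), \<sigma> \<circ> \<tau>)),
      one = (\<lambda>_. 1, id)\<rparr>"

text \<open>
  Transport of a structure matrix along the linear map given by \<open>(a, \<sigma>)\<close>: the square of a unit vector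
  scales quadratically, whence the exponent.
\<close>

definition monomial_act ::
  "('n \<Rightarrow> 'f::field) \<times> ('n \<Rightarrow> 'n) \<Rightarrow> 'f ^ 'n ^ 'n \<Rightarrow> 'f ^ 'n ^ 'n" where
  "monomial_act g A = (case g of (a, \<sigma>) \<Rightarrow> \<chi> k l. a k * A $ \<sigma> k $ \<sigma> l / (a l)\<^sup>2)"

lemma carrier_monomial_group: "(a, \<sigma>) \<in> carrier monomial_group \<longleftrightarrow> (\<forall>i. a i \<noteq> 0) \<and> bij \<sigma>"
  by (simp add: monomial_group_def)

lemma group_monomial_group: "group (monomial_group :: (('n::finite \<Rightarrow> 'f::field) \<times> ('n \<Rightarrow> 'n)) monoid)"
proof (rule groupI)
  fix g :: "('n \<Rightarrow> 'f) \<times> ('n \<Rightarrow> 'n)" assume g: "g \<in> carrier monomial_group"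
  obtain a \<sigma> where g_eq: "g = (a, \<sigma>)" by (cases g)
  have a: "a i \<noteq> 0" and \<sigma>: "bij \<sigma>" for i using g by (auto simp: g_eq carrier_monomial_group)
  show "\<exists>h\<in>carrier monomial_group. h \<otimes>\<^bsub>monomial_group\<^esub> g = \<one>\<^bsub>monomial_group\<^esub>"
    using a \<sigma>
    by (intro bexI[of _ "(\<lambda>k. inverse (a (inv_into UNIV \<sigma> k)), inv_into UNIV \<sigma>)"])
       (auto simp: monomial_group_def g_eq bij_imp_bij_inv fun_eq_iff bij_is_surj surj_f_inv_f)
qed (auto simp: monomial_group_def bij_comp mult.assoc comp_assoc)

lemma monomial_act_mult:
  "monomial_act (g \<otimes>\<^bsub>monomial_group\<^esub> h) A = monomial_act g (monomial_act h A)"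
  by (auto simp: monomial_act_def monomial_group_def vec_eq_iff power_mult_distrib mult_ac split: prod.splits)

lemma algebra_iso_monomial_act:
  fixes A :: "'f::field ^ 'n ^ 'n"
  assumes g: "(a, \<sigma>) \<in> carrier monomial_group"
  shows "algebra_iso (*s) (evolution_mult A) (*s) (evolution_mult (monomial_act (a, \<sigma>) A))
           (\<lambda>x. \<chi> k. a k * x $ \<sigma> k)"
proof -
  have a: "a i \<noteq> 0" and \<sigma>: "bij \<sigma>" for i using g by (auto simp: carrier_monomial_group)
  let ?f = "\<lambda>x :: 'f ^ 'n. \<chi> k. a k * x $ \<sigma> k"
  have "Vector_Spaces.linear (*s) (*s) ?f"
    by unfold_locales (simp_all add: vec_eq_iff algebra_simps)
  moreover have "bij ?f"
    by (rule o_bij[of "\<lambda>y. \<chi> l. y $ inv_into UNIV \<sigma> l / a (inv_into UNIV \<sigma> l)"])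
       (use a \<sigma> in \<open>auto simp: vec_eq_iff fun_eq_iff bij_is_inj bij_is_surj surj_f_inv_f inv_f_f\<close>)
  moreover have "?f (evolution_mult A x y) = evolution_mult (monomial_act (a, \<sigma>) A) (?f x) (?f y)" for x y
  proof -
    have "(\<Sum>l\<in>UNIV. a k * (A $ \<sigma> k $ l * (x $ l * y $ l))) =
          (\<Sum>l\<in>UNIV. a k * A $ \<sigma> k $ \<sigma> l / (a l)\<^sup>2 * (a l * x $ \<sigma> l * (a l * y $ \<sigma> l)))" for k
      by (subst sum.reindex_bij_betw[OF \<sigma>, symmetric], rule sum.cong)
         (use a in \<open>auto simp: power2_eq_square field_simps\<close>)
    then show ?thesis
      by (simp add: vec_eq_iff evolution_mult_def matrix_vector_mult_def monomial_act_def sum_distrib_left)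
  qed
  ultimately show ?thesis by (auto simp: algebra_iso_def)
qed

text \<open>
  The natural basis of an idempotent evolution algebra is unique up to order and scaling. If
  \<open>f\<close> is an isomorphism and \<open>i \<noteq> j\<close>, then \<open>e\<^sub>i e\<^sub>j = 0\<close> gives
  \<open>B (f e\<^sub>i \<circ> f e\<^sub>j) = 0\<close> for the coordinatewise product \<open>\<circ>\<close>. As \<open>B\<close> is injective,
  no coordinate of \<open>f e\<^sub>i\<close> and \<open>f e\<^sub>j\<close> is nonzero at the same time. So every row of the
  matrix of \<open>f\<close> has one nonzero entry, that is, \<open>f\<close> is monomial.
\<close>

lemma algebra_iso_imp_monomial_act:
  fixes A B :: "'f::field ^ 'n ^ 'n"
  assumes invB: "invertible B"
    and iso: "algebra_iso (*s) (evolution_mult A) (*s) (evolution_mult B) f"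
  obtains g where "g \<in> carrier monomial_group" "B = monomial_act g A"
proof -
  have lin: "Vector_Spaces.linear (*s) (*s) f" and b: "bij f"
    and h: "\<And>x y. f (evolution_mult A x y) = evolution_mult B (f x) (f y)"
    using iso by (auto simp: algebra_iso_def)
  interpret b: nonassoc_algebra "(*s)" "evolution_mult B"
    by (rule nonassoc_algebra_evolution_mult)
  define P where "P k i = f (axis i 1) $ k" for k i
  have f_eq: "f x $ k = (\<Sum>i\<in>UNIV. P k i * x $ i)" for x k
    using linear_componentwise[OF lin, of x k] by (simp add: P_def mult.commute)
  have row: "P k i = 0 \<or> P k j = 0" if "i \<noteq> j" for i j k
  proof -
    have "evolution_mult B (f (axis i 1)) (f (axis j 1)) = 0"
      using that by (simp flip: h add: evolution_mult_axis vec.linear_0[OF lin])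
    moreover have "inj ((*v) B)" using invB by (simp add: invertible_eq_bij bij_is_inj)
    ultimately have "(\<chi> k. f (axis i 1) $ k * f (axis j 1) $ k) = 0"
      unfolding evolution_mult_def by (metis injD matrix_vector_mult_0_right)
    then show ?thesis by (auto simp: vec_eq_iff P_def)
  qed
  have "\<exists>i. P k i \<noteq> 0" for k
  proof (rule ccontr)
    assume "\<nexists>i. P k i \<noteq> 0"
    then have "f x $ k = 0" for x by (simp add: f_eq)
    moreover obtain x where "f x = axis k 1" using b by (metis bij_pointE)
    ultimately show False by (metis axis_nth zero_neq_one)
  qed
  then obtain \<sigma> where \<sigma>: "P k (\<sigma> k) \<noteq> 0" for k by metis
  have P0: "P k i = 0" if "i \<noteq> \<sigma> k" for k i using row[OF that, of k] \<sigma> by auto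
  have f_eq': "f x $ k = P k (\<sigma> k) * x $ \<sigma> k" for x k
  proof -
    have "f x $ k = (\<Sum>i\<in>UNIV. if i = \<sigma> k then P k i * x $ i else 0)"
      unfolding f_eq by (intro sum.cong) (auto simp: P0)
    then show ?thesis by simp
  qed
  have "surj \<sigma>"
  proof (rule ccontr)
    assume "\<not> surj \<sigma>"
    then obtain i where i: "\<And>k. \<sigma> k \<noteq> i" by (metis surjI)
    then have "f (axis i 1) = f 0" by (auto simp: vec_eq_iff f_eq' axis_def)
    then have "axis i (1::'f) = 0" using b by (metis bij_is_inj injD)
    then show False by (simp add: axis_eq_0_iff)
  qed
  then have bs: "bij \<sigma>" by (simp add: bij_def finite_UNIV_surj_inj)
  let ?a = "\<lambda>k. P k (\<sigma> k)"
  have "B $ k $ l = ?a k * A $ \<sigma> k $ \<sigma> l / (?a l)\<^sup>2" for k l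
  proof -
    have fa: "f (axis (\<sigma> l) 1) = ?a l *s axis l 1"
      using bs by (auto simp: vec_eq_iff f_eq' axis_def bij_is_inj inj_eq)
    have "?a k * A $ \<sigma> k $ \<sigma> l = f (evolution_mult A (axis (\<sigma> l) 1) (axis (\<sigma> l) 1)) $ k"
      by (simp add: f_eq' evolution_mult_axis column_def)
    also have "\<dots> = evolution_mult B (?a l *s axis l 1) (?a l *s axis l 1) $ k"
      by (simp add: h fa)
    also have "\<dots> = B $ k $ l * (?a l)\<^sup>2"
      by (simp add: vec.linear_scale[OF b.linear_mult_left] vec.linear_scale[OF b.linear_mult_right]
          evolution_mult_axis column_def power2_eq_square)
    finally show ?thesis using \<sigma>[of l] by (simp add: field_simps)
  qed
  then have "B = monomial_act (?a, \<sigma>) A" by (simp add: monomial_act_def vec_eq_iff)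
  moreover have "(?a, \<sigma>) \<in> carrier monomial_group" using \<sigma> bs by (simp add: carrier_monomial_group)
  ultimately show thesis using that by blast
qed

lemma invertible_monomial_act:
  fixes A :: "'f::field ^ 'n ^ 'n"
  assumes g: "g \<in> carrier monomial_group" and A: "invertible A"
  shows "invertible (monomial_act g A)"
  using idempotent_evolution_algebra_transfer[OF algebra_iso_monomial_act, of "fst g" "snd g" A "CARD('n)"]
    g A evolution_mult_in_coord_algebras_iff[of A] evolution_mult_in_coord_algebras_iff[of "monomial_act g A"]
  by (simp add: coord_algebras_def)

lemma monomial_act_one: "monomial_act \<one>\<^bsub>monomial_group\<^esub> A = A"
  by (simp add: monomial_act_def monomial_group_def vec_eq_iff)

text \<open>
  The action is cut off outside the invertible matrices because elements of the symmetric group of a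
  set are functions that take a default value off that set.
\<close>

lemma group_action_monomial:
  "group_action monomial_group {A :: 'f::field ^ 'n ^ 'n. invertible A}
     (\<lambda>g. restrict (monomial_act g) {A. invertible A})"
proof -
  let ?X = "{A :: 'f ^ 'n ^ 'n. invertible A}"
  interpret group "monomial_group :: (('n \<Rightarrow> 'f) \<times> ('n \<Rightarrow> 'n)) monoid" by (rule group_monomial_group)
  have bij: "restrict (monomial_act g) ?X \<in> carrier (BijGroup ?X)" if "g \<in> carrier monomial_group" for g
  proof -
    have "bij_betw (monomial_act g) ?X ?X"
      by (rule bij_betw_byWitness[of _ "monomial_act (inv\<^bsub>monomial_group\<^esub> g)"])
         (use that in \<open>auto simp: invertible_monomial_act monomial_act_one simp flip: monomial_act_mult\<close>)
    then show ?thesis by (simp add: BijGroup_def Bij_def)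
  qed
  show ?thesis
  proof (intro group_action.intro group_hom.intro group_hom_axioms.intro homI)
    show "group (BijGroup ?X)" by (rule group_BijGroup)
    show "group (monomial_group :: (('n \<Rightarrow> 'f) \<times> ('n \<Rightarrow> 'n)) monoid)" by (rule group_monomial_group)
    fix g h :: "('n \<Rightarrow> 'f) \<times> ('n \<Rightarrow> 'n)"
    assume g: "g \<in> carrier monomial_group" and h: "h \<in> carrier monomial_group"
    show "restrict (monomial_act (g \<otimes>\<^bsub>monomial_group\<^esub> h)) ?X =
          restrict (monomial_act g) ?X \<otimes>\<^bsub>BijGroup ?X\<^esub> restrict (monomial_act h) ?X"
      using bij[OF g] bij[OF h] h
      by (auto simp: BijGroup_def compose_def monomial_act_mult invertible_monomial_act intro!: restrict_ext)
  qed (use bij in auto)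
qed

text \<open>
  Every class contains some algebra given by a structure matrix, and two such algebras are isomorphic
  exactly when a monomial transformation carries one matrix to the other.
\<close>

lemma card_isomorphism_classes_eq_orbits:
  "num_idempotent_evolution_algebras TYPE('n::finite) TYPE('f::field) =
   card (orbits monomial_group {A :: 'f ^ 'n ^ 'n. invertible A}
           (\<lambda>g. restrict (monomial_act g) {A. invertible A}))"
proof -
  let ?X = "{A :: 'f ^ 'n ^ 'n. invertible A}"
  let ?orb = "orbit monomial_group (\<lambda>g. restrict (monomial_act g) ?X)"
  let ?C = "coord_algebras :: ('f ^ 'n \<Rightarrow> 'f ^ 'n \<Rightarrow> 'f ^ 'n) set"
  interpret group_action "monomial_group :: (('n \<Rightarrow> 'f) \<times> ('n \<Rightarrow> 'n)) monoid" ?X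
    "\<lambda>g. restrict (monomial_act g) ?X" by (rule group_action_monomial)
  have orb: "(evolution_mult A, evolution_mult B) \<in> coord_iso \<longleftrightarrow> B \<in> ?orb A" if "A \<in> ?X" "B \<in> ?X" for A B
  proof -
    have "B \<in> ?orb A \<longleftrightarrow> (\<exists>g\<in>carrier monomial_group. B = monomial_act g A)"
      using that by (auto simp: orbit_def)
    also have "\<dots> \<longleftrightarrow> (\<exists>f. algebra_iso (*s) (evolution_mult A) (*s) (evolution_mult B) f)"
    proof
      assume "\<exists>g\<in>carrier monomial_group. B = monomial_act g A"
      then obtain a \<sigma> where "(a, \<sigma>) \<in> carrier monomial_group" "B = monomial_act (a, \<sigma>) A"
        by auto
      then show "\<exists>f. algebra_iso (*s) (evolution_mult A) (*s) (evolution_mult B) f"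
        using algebra_iso_monomial_act by blast
    next
      assume "\<exists>f. algebra_iso (*s) (evolution_mult A) (*s) (evolution_mult B) f"
      then show "\<exists>g\<in>carrier monomial_group. B = monomial_act g A"
        using algebra_iso_imp_monomial_act[of B A] that by blast
    qed
    finally show ?thesis
      using that by (simp add: coord_iso_def evolution_mult_in_coord_algebras_iff)
  qed
  have "bij_betw (\<lambda>Z. coord_iso `` (evolution_mult ` Z)) (orbits monomial_group ?X (\<lambda>g. restrict (monomial_act g) ?X))
     (?C // coord_iso)"
  proof -
    have sub: "B \<in> ?X" if "A \<in> ?X" "B \<in> ?orb A" for A B
      using that by (auto simp: orbit_def invertible_monomial_act)
    have img: "coord_iso `` (evolution_mult ` ?orb A) = coord_iso `` {evolution_mult A}" if A: "A \<in> ?X" for A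
    proof -
      have "coord_iso `` {evolution_mult B} = coord_iso `` {evolution_mult A}" if "B \<in> ?orb A" for B
        using equiv_class_eq[OF equiv_coord_iso] orb[OF A sub[OF A that]] that by metis
      moreover have "A \<in> ?orb A" using A by (rule orbit_refl)
      ultimately show ?thesis by blast
    qed
    show ?thesis
      unfolding bij_betw_def
    proof
      show "inj_on (\<lambda>Z. coord_iso `` (evolution_mult ` Z)) (orbits monomial_group ?X (\<lambda>g. restrict (monomial_act g) ?X))"
      proof (rule inj_onI)
        fix O1 O2
        assume "O1 \<in> orbits monomial_group ?X (\<lambda>g. restrict (monomial_act g) ?X)"
          "O2 \<in> orbits monomial_group ?X (\<lambda>g. restrict (monomial_act g) ?X)"
          and eq: "coord_iso `` (evolution_mult ` O1) = coord_iso `` (evolution_mult ` O2)"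
        then obtain A B where A: "A \<in> ?X" "O1 = ?orb A" and B: "B \<in> ?X" "O2 = ?orb B"
          by (auto simp: orbits_def)
        have "(evolution_mult A, evolution_mult B) \<in> coord_iso"
          using eq A B eq_equiv_class_iff[OF equiv_coord_iso, of "evolution_mult A" "evolution_mult B"]
          by (simp add: img evolution_mult_in_coord_algebras_iff)
        then have "B \<in> ?orb A" using A B orb by blast
        then show "O1 = O2" unfolding A(2) B(2)
          using orbit_trans[OF A(1) B(1)] orbit_trans[OF B(1) A(1)] orbit_sym[OF A(1) B(1)] sub A(1) B(1)
          by blast
      qed
      have ex: "\<exists>A\<in>?X. (m, evolution_mult A) \<in> coord_iso" if m: "m \<in> ?C" for m
      proof -
        obtain A :: "'f ^ 'n ^ 'n" and f where "invertible A" "algebra_iso (*s) m (*s) (evolution_mult A) f"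
          using coord_algebra_iso_evolution_mult[OF m] .
        with m show ?thesis
          by (intro bexI[of _ A]) (auto simp: coord_iso_def evolution_mult_in_coord_algebras_iff)
      qed
      have "?C // coord_iso = (\<lambda>A. coord_iso `` {evolution_mult A}) ` ?X"
      proof (intro equalityI subsetI)
        fix Z assume "Z \<in> ?C // coord_iso"
        then obtain m where m: "m \<in> ?C" "Z = coord_iso `` {m}" by (rule quotientE)
        with ex[OF m(1)] show "Z \<in> (\<lambda>A. coord_iso `` {evolution_mult A}) ` ?X"
          using equiv_class_eq[OF equiv_coord_iso] by blast
      qed (auto intro: quotientI simp: evolution_mult_in_coord_algebras_iff)
      moreover have "orbits monomial_group ?X (\<lambda>g. restrict (monomial_act g) ?X) = ?orb ` ?X"
        by (auto simp: orbits_def)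
      ultimately show "(\<lambda>Z. coord_iso `` (evolution_mult ` Z)) ` orbits monomial_group ?X
          (\<lambda>g. restrict (monomial_act g) ?X) = ?C // coord_iso"
        using img by (simp add: image_image)
    qed
  qed
  then show ?thesis
    by (simp add: num_idempotent_evolution_algebras_def bij_betw_same_card)
qed

section \<open>Roots of unity and the characteristic of a finite field\<close>

text \<open>
  Multiplication by \<open>x\<close> permutes the nonzero elements, hence preserves their product.
\<close>

lemma finite_field_power_card_minus_1:
  fixes x :: "'f::{field,finite}"
  assumes "x \<noteq> 0"
  shows "x ^ (CARD('f) - 1) = 1"
proof -
  have "(\<Prod>y\<in>UNIV-{0}. x * y) = (\<Prod>y\<in>UNIV-{0}. y)"
    by (rule prod.reindex_bij_witness[of _ "\<lambda>y. y / x" "\<lambda>y. x * y"]) (use assms in auto)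
  then have "x ^ (CARD('f) - 1) * \<Prod>(UNIV-{0}) = \<Prod>(UNIV-{0})"
    by (simp add: prod.distrib card_Diff_singleton)
  then show ?thesis by simp
qed

lemma card_roots_of_unity_le:
  assumes "n > 0"
  shows "card {x :: 'f::{field,finite}. x ^ n = 1} \<le> n"
proof -
  let ?p = "Polynomial.monom 1 n - 1 :: 'f poly"
  have "Polynomial.coeff ?p n = 1" using assms by (simp add: coeff_1)
  then have "?p \<noteq> 0" by (metis coeff_0 zero_neq_one)
  moreover have "Polynomial.degree ?p \<le> n" by (intro degree_diff_le) (auto simp: degree_monom_eq)
  moreover have "{x. x ^ n = 1} = {x. poly ?p x = 0}" by (simp add: poly_monom)
  ultimately show ?thesis using card_poly_roots_bound[of ?p] by simp
qed

lemma one_root_of_unity_if_coprime: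
  fixes x :: "'f::{field,finite}"
  assumes "prime r" "\<not> r dvd CARD('f) - 1" "x ^ r = 1"
  shows "x = 1"
proof -
  have x0: "x \<noteq> 0" using assms(1,3) by (auto simp: power_0_left prime_gt_0_nat)
  have "coprime (CARD('f) - 1) r"
    using assms by (simp add: coprime_commute prime_imp_coprime)
  then obtain u v where uv: "(CARD('f) - 1) * u = r * v + 1"
    using coprime_bezout_strong[of "CARD('f) - 1" r] prime_gt_1_nat[OF assms(1)] by auto
  have "1 = x ^ ((CARD('f) - 1) * u)"
    using finite_field_power_card_minus_1[OF x0] by (simp only: power_mult power_one)
  also have "\<dots> = x" unfolding uv using assms(3) by (simp add: power_add power_mult)
  finally show ?thesis ..
qed

text \<open>
  Write \<open>q - 1 = r k\<close>. The polynomial \<open>X\<^sup>k - 1\<close> has too few roots to vanish on all nonzero elements, so some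
  \<open>w = x\<^sup>k\<close> differs from 1; it satisfies \<open>w\<^sup>r = 1\<close>, and as \<open>r\<close> is prime its first \<open>r\<close> powers are
  distinct. They exhaust the roots of \<open>X\<^sup>r - 1\<close>.
\<close>

lemma card_prime_roots_of_unity:
  assumes "prime r" "r dvd CARD('f::{field,finite}) - 1"
  shows "card {x :: 'f. x ^ r = 1} = r"
proof (rule antisym)
  have r: "r > 1" using assms(1) by (rule prime_gt_1_nat)
  show "card {x :: 'f. x ^ r = 1} \<le> r" using r by (intro card_roots_of_unity_le) simp
  have "card {0, 1 :: 'f} \<le> CARD('f)" by (intro card_mono) auto
  then have q: "CARD('f) - 1 > 0" by simp
  obtain k where k: "CARD('f) - 1 = r * k" using assms(2) by (elim dvdE)
  then have "k > 0" using q by (cases k) auto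
  have "\<exists>x :: 'f. x \<noteq> 0 \<and> x ^ k \<noteq> 1"
  proof (rule ccontr)
    assume "\<not> ?thesis"
    then have "UNIV - {0} \<subseteq> {x :: 'f. x ^ k = 1}" by auto
    then have "card (UNIV - {0 :: 'f}) \<le> card {x :: 'f. x ^ k = 1}" by (intro card_mono) auto
    moreover have "card (UNIV - {0 :: 'f}) = r * k" using k by (simp add: card_Diff_singleton)
    ultimately have "r * k \<le> k"
      using card_roots_of_unity_le[OF \<open>k > 0\<close>, where ?'f = 'f] by linarith
    then show False using r \<open>k > 0\<close> by simp
  qed
  then obtain x :: 'f where x: "x \<noteq> 0" "x ^ k \<noteq> 1" by blast
  define w where "w = x ^ k"
  have w: "w ^ r = 1" "w \<noteq> 1"
    using x finite_field_power_card_minus_1[OF x(1)]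
    unfolding w_def k by (simp_all add: mult.commute flip: power_mult)
  have w0: "w \<noteq> 0" using x by (simp add: w_def)
  have eq: "m = n" if "m < r" "n \<le> m" "w ^ m = w ^ n" for m n
  proof (rule ccontr)
    assume "m \<noteq> n"
    then have d: "0 < m - n" "m - n < r" using that by auto
    have "w ^ n * w ^ (m - n) = w ^ n * 1" using that by (simp flip: power_add)
    then have w1: "w ^ (m - n) = 1" using w0 by (metis mult_cancel_left power_not_zero)
    have "coprime (m - n) r"
      using d assms(1) by (metis coprime_commute nat_dvd_not_less prime_imp_coprime)
    then obtain u v where uv: "(m - n) * u = r * v + 1"
      using coprime_bezout_strong[of "m - n" r] r by auto
    have "1 = w ^ ((m - n) * u)" using w1 by (simp add: power_mult)
    also have "\<dots> = w" unfolding uv using w by (simp add: power_add power_mult)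
    finally show False using w by simp
  qed
  have "inj_on (\<lambda>n. w ^ n) {..<r}"
    using eq by (intro inj_onI) (metis lessThan_iff nat_le_linear)
  moreover have "(\<lambda>n. w ^ n) ` {..<r} \<subseteq> {x. x ^ r = 1}"
    using w by (auto simp: power_mult[symmetric] mult.commute[of _ r]) (simp add: power_mult)
  ultimately have "card {..<r} \<le> card {x :: 'f. x ^ r = 1}"
    by (intro card_inj_on_le[of "\<lambda>n. w ^ n"]) auto
  then show "r \<le> card {x :: 'f. x ^ r = 1}" by simp
qed

lemma card_nontrivial_roots_of_unity:
  assumes "prime r"
  shows "card {x :: 'f::{field,finite}. x ^ r = 1 \<and> x \<noteq> 1} = (if r dvd CARD('f) - 1 then r - 1 else 0)"
proof -
  have eq: "{x :: 'f. x ^ r = 1 \<and> x \<noteq> 1} = {x. x ^ r = 1} - {1}" by auto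
  show ?thesis
  proof (cases "r dvd CARD('f) - 1")
    case True
    then show ?thesis using card_prime_roots_of_unity[OF assms True] by (simp add: eq card_Diff_singleton)
  next
    case False
    then have "{x :: 'f. x ^ r = 1 \<and> x \<noteq> 1} = {}" using one_root_of_unity_if_coprime[OF assms] by auto
    then show ?thesis using False by simp
  qed
qed

text \<open>
  The characteristic is a prime that divides the cardinality \<open>p\<^sup>m\<close>.
\<close>

lemma of_nat_prime_eq_0_iff:
  assumes "prime p" "prime r" "CARD('f::{field,finite}) = p ^ m"
  shows "(of_nat r :: 'f) = 0 \<longleftrightarrow> r = p"
proof -
  have "prime CHAR('f)"
    by (rule prime_CHAR_semidom) (simp add: finite_imp_CHAR_pos)
  moreover have "CHAR('f) dvd p ^ m" using CHAR_dvd_CARD[where ?'a = 'f] assms(3) by simp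
  ultimately have "CHAR('f) = p"
    using assms(1) by (metis prime_dvd_power primes_dvd_imp_eq)
  then show ?thesis
    using assms primes_dvd_imp_eq[of p r] by (auto simp: of_nat_eq_0_iff_char_dvd)
qed

section \<open>Point counts over a finite field\<close>

lemma card_Sigma_const:
  assumes "finite A" "\<And>x. x \<in> A \<Longrightarrow> finite (B x)" "\<And>x. x \<in> A \<Longrightarrow> real (card (B x)) = k"
  shows "real (card (Sigma A B)) = real (card A) * k"
  using assms by (simp add: card_SigmaI)

lemma real_card_nonzero: "real (card {x :: 'f::{field,finite}. x \<noteq> 0}) = real CARD('f) - 1"
proof -
  have eq: "{x :: 'f. x \<noteq> 0} = UNIV - {0}" by auto
  show ?thesis unfolding eq by (subst card_Diff_singleton) (simp_all add: of_nat_diff Suc_leI)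
qed

text \<open>
  A nonzero linear form can be used as one of the coordinates; the same holds for three variables.
\<close>

lemma card_linear_form_2:
  fixes a b :: "'f::{field,finite}"
  assumes "a \<noteq> 0 \<or> b \<noteq> 0"
  shows "real (card {(x, y). a * x + b * y \<noteq> 0}) = (real CARD('f) - 1) * real CARD('f)"
proof (cases "a = 0")
  case False
  have "bij_betw (\<lambda>(x, y). (a * x + b * y, y)) {(x, y). a * x + b * y \<noteq> 0} ({s. s \<noteq> 0} \<times> UNIV)"
    by (rule bij_betw_byWitness[of _ "\<lambda>(s, y). ((s - b * y) / a, y)"]) (use False in auto)
  then show ?thesis by (simp add: bij_betw_same_card card_cartesian_product real_card_nonzero)
next
  case True
  have "bij_betw (\<lambda>(x, y). (a * x + b * y, x)) {(x, y). a * x + b * y \<noteq> 0} ({s. s \<noteq> 0} \<times> UNIV)"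
    by (rule bij_betw_byWitness[of _ "\<lambda>(s, x). (x, s / b)"]) (use True assms in auto)
  then show ?thesis by (simp add: bij_betw_same_card card_cartesian_product real_card_nonzero)
qed

lemma card_linear_form_3:
  fixes a b c :: "'f::{field,finite}"
  assumes "a \<noteq> 0 \<or> b \<noteq> 0 \<or> c \<noteq> 0"
  shows "real (card {(x, y, z). a * x + b * y + c * z \<noteq> 0}) = (real CARD('f) - 1) * real CARD('f) ^ 2"
proof (cases "a = 0")
  case False
  have "bij_betw (\<lambda>(x, y, z). (a * x + b * y + c * z, y, z)) {(x, y, z). a * x + b * y + c * z \<noteq> 0}
          ({s. s \<noteq> 0} \<times> UNIV)"
    by (rule bij_betw_byWitness[of _ "\<lambda>(s, y, z). ((s - b * y - c * z) / a, y, z)"]) (use False in auto)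
  then show ?thesis
    by (simp add: bij_betw_same_card card_cartesian_product real_card_nonzero power2_eq_square)
next
  case True
  have "bij_betw (\<lambda>(x, y, z). (x, y, z)) {(x, y, z). a * x + b * y + c * z \<noteq> 0}
          (UNIV \<times> {(y, z). b * y + c * z \<noteq> 0})"
    by (rule bij_betw_byWitness[of _ "\<lambda>(x, y, z). (x, y, z)"]) (use True in auto)
  then show ?thesis
    using True assms
    by (simp add: bij_betw_same_card card_cartesian_product card_linear_form_2 power2_eq_square)
qed

lemma real_card_nonzero_pairs:
  "real (card {(x :: 'f::{field,finite}, y :: 'f). x \<noteq> 0 \<or> y \<noteq> 0}) = real CARD('f) ^ 2 - 1"
proof -
  have eq: "{(x :: 'f, y :: 'f). x \<noteq> 0 \<or> y \<noteq> 0} = UNIV - {(0, 0)}" by auto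
  show ?thesis unfolding eq
    by (subst card_Diff_singleton) (simp_all add: of_nat_diff Suc_leI power2_eq_square card_cartesian_product flip: UNIV_Times_UNIV)
qed

lemma real_card_nonzero_triples:
  "real (card {(x :: 'f::{field,finite}, y :: 'f, z :: 'f). x \<noteq> 0 \<or> y \<noteq> 0 \<or> z \<noteq> 0}) = real CARD('f) ^ 3 - 1"
proof -
  have eq: "{(x :: 'f, y :: 'f, z :: 'f). x \<noteq> 0 \<or> y \<noteq> 0 \<or> z \<noteq> 0} = UNIV - {(0, 0, 0)}" by auto
  show ?thesis unfolding eq
    by (subst card_Diff_singleton) (simp_all add: of_nat_diff Suc_leI power3_eq_cube card_cartesian_product flip: UNIV_Times_UNIV)
qed

text \<open>
  The rows of the matrix are \<open>(x, u)\<close> and \<open>(v, y)\<close>: once the first row is nonzero, the determinant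
  is a nonzero linear form in the second.
\<close>

lemma card_nonsingular_2:
  "real (card {((x :: 'f::{field,finite}, u), (y, v)). x * y - u * v \<noteq> 0}) =
   (real CARD('f) ^ 2 - 1) * ((real CARD('f) - 1) * real CARD('f))"
proof -
  have "{((x :: 'f, u), (y, v)). x * y - u * v \<noteq> 0} =
        Sigma {(x, u). x \<noteq> 0 \<or> u \<noteq> 0} (\<lambda>(x, u). {(y, v). x * y + (- u) * v \<noteq> 0})"
    by auto
  also have "real (card \<dots>) = real (card {(x :: 'f, u :: 'f). x \<noteq> 0 \<or> u \<noteq> 0}) * ((real CARD('f) - 1) * real CARD('f))"
  proof (rule card_Sigma_const)
    fix p :: "'f \<times> 'f" assume p: "p \<in> {(x, u). x \<noteq> 0 \<or> u \<noteq> 0}"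
    obtain x u where p_eq: "p = (x, u)" by (cases p)
    show "real (card (case p of (x, u) \<Rightarrow> {(y, v). x * y + (- u) * v \<noteq> 0})) = (real CARD('f) - 1) * real CARD('f)"
      using p card_linear_form_2[of x "- u"] unfolding p_eq prod.case by simp
  qed auto
  finally show ?thesis by (simp only: real_card_nonzero_pairs)
qed

text \<open>
  The cross product of two vectors vanishes exactly on the multiples of the first one.
\<close>

lemma card_nonproportional:
  fixes u1 u2 u3 :: "'f::{field,finite}"
  assumes u: "u1 \<noteq> 0 \<or> u2 \<noteq> 0 \<or> u3 \<noteq> 0"
  shows "real (card {(v1, v2, v3). u2 * v3 - u3 * v2 \<noteq> 0 \<or> u3 * v1 - u1 * v3 \<noteq> 0 \<or> u1 * v2 - u2 * v1 \<noteq> 0}) =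
    real CARD('f) ^ 3 - real CARD('f)"
proof -
  let ?S = "range (\<lambda>t. (t * u1, t * u2, t * u3))"
  have "v \<in> ?S \<longleftrightarrow> (case v of (v1, v2, v3) \<Rightarrow> u2 * v3 = u3 * v2 \<and> u3 * v1 = u1 * v3 \<and> u1 * v2 = u2 * v1)" for v
  proof -
    obtain v1 v2 v3 where v: "v = (v1, v2, v3)" by (cases v)
    have "v \<in> ?S" if "u2 * v3 = u3 * v2" "u3 * v1 = u1 * v3" "u1 * v2 = u2 * v1"
    proof -
      consider "u1 \<noteq> 0" | "u2 \<noteq> 0" | "u3 \<noteq> 0" using u by blast
      then show ?thesis
      proof cases
        case 1 then show ?thesis using that unfolding v by (intro image_eqI[of _ _ "v1 / u1"]) (auto simp: field_simps)
      next
        case 2 then show ?thesis using that unfolding v by (intro image_eqI[of _ _ "v2 / u2"]) (auto simp: field_simps)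
      next
        case 3 then show ?thesis using that unfolding v by (intro image_eqI[of _ _ "v3 / u3"]) (auto simp: field_simps)
      qed
    qed
    then show ?thesis by (auto simp: v)
  qed
  then have eq: "{(v1, v2, v3). u2 * v3 - u3 * v2 \<noteq> 0 \<or> u3 * v1 - u1 * v3 \<noteq> 0 \<or> u1 * v2 - u2 * v1 \<noteq> 0} = UNIV - ?S"
    by auto
  have "inj (\<lambda>t. (t * u1, t * u2, t * u3))" using u by (auto intro: injI)
  then have c: "card ?S = CARD('f)" by (rule card_image)
  have C: "CARD('f \<times> 'f \<times> 'f) = CARD('f) ^ 3" by (simp add: power3_eq_cube card_cartesian_product flip: UNIV_Times_UNIV)
  have "CARD('f) ^ 1 \<le> CARD('f) ^ 3" by (intro power_increasing) (auto simp: Suc_leI)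
  then show ?thesis unfolding eq by (subst card_Diff_subset) (simp_all add: c C of_nat_diff power3_eq_cube)
qed

text \<open>
  The rows are chosen one after the other: a nonzero vector \<open>u\<close>, a vector \<open>v\<close> not proportional to it, and
  a vector on which the linear form \<open>(u \<times> v) \<bullet> _\<close>, which is the determinant, does not vanish.
\<close>

lemma card_nonsingular_3:
  "real (card {A :: 'f::{field,finite} ^ 3 ^ 3. det A \<noteq> 0}) =
   (real CARD('f) ^ 3 - 1) * (real CARD('f) ^ 3 - real CARD('f)) * ((real CARD('f) - 1) * real CARD('f) ^ 2)"
proof -
  let ?N = "\<lambda>(u1, u2, u3). {(v1, v2, v3). u2 * v3 - u3 * v2 \<noteq> 0 \<or> u3 * v1 - u1 * v3 \<noteq> 0 \<or> u1 * v2 - u2 * v1 \<noteq> (0 :: 'f)}"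
  let ?U = "{(u1 :: 'f, u2 :: 'f, u3 :: 'f). u1 \<noteq> 0 \<or> u2 \<noteq> 0 \<or> u3 \<noteq> 0}"
  let ?W = "\<lambda>((u1, u2, u3), (v1, v2, v3)). {(x, y, z). (u2 * v3 - u3 * v2) * x + (u3 * v1 - u1 * v3) * y + (u1 * v2 - u2 * v1) * z \<noteq> (0 :: 'f)}"
  have "bij_betw (\<lambda>A :: 'f ^ 3 ^ 3. (((A$1$1, A$1$2, A$1$3), (A$2$1, A$2$2, A$2$3)), (A$3$1, A$3$2, A$3$3)))
          {A. det A \<noteq> 0} (Sigma (Sigma ?U ?N) ?W)"
  proof (rule bij_betw_byWitness[of _
        "\<lambda>(((u1, u2, u3), (v1, v2, v3)), (x, y, z)). vector [vector [u1, u2, u3], vector [v1, v2, v3], vector [x, y, z]]"])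
    show "(\<lambda>A :: 'f ^ 3 ^ 3. (((A$1$1, A$1$2, A$1$3), (A$2$1, A$2$2, A$2$3)), (A$3$1, A$3$2, A$3$3))) `
          {A. det A \<noteq> 0} \<subseteq> Sigma (Sigma ?U ?N) ?W"
    proof
      fix t assume "t \<in> (\<lambda>A :: 'f ^ 3 ^ 3. (((A$1$1, A$1$2, A$1$3), (A$2$1, A$2$2, A$2$3)), (A$3$1, A$3$2, A$3$3))) `
          {A. det A \<noteq> 0}"
      then obtain A :: "'f ^ 3 ^ 3" where A: "det A \<noteq> 0"
        and t: "t = (((A$1$1, A$1$2, A$1$3), (A$2$1, A$2$2, A$2$3)), (A$3$1, A$3$2, A$3$3))" by blast
      have d: "(A$1$2 * A$2$3 - A$1$3 * A$2$2) * A$3$1 + (A$1$3 * A$2$1 - A$1$1 * A$2$3) * A$3$2 +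
          (A$1$1 * A$2$2 - A$1$2 * A$2$1) * A$3$3 \<noteq> 0"
        using A by (simp add: det_3 algebra_simps)
      show "t \<in> Sigma (Sigma ?U ?N) ?W" using d unfolding t by auto
    qed
    show "(\<lambda>(((u1, u2, u3), (v1, v2, v3)), (x, y, z)). vector [vector [u1, u2, u3], vector [v1, v2, v3], vector [x, y, z]]) `
        (Sigma (Sigma ?U ?N) ?W) \<subseteq> {A :: 'f ^ 3 ^ 3. det A \<noteq> 0}"
      by (auto simp: det_3 algebra_simps)
  qed (auto simp: vec_eq_iff forall_3)
  then have 1: "card {A :: 'f ^ 3 ^ 3. det A \<noteq> 0} = card (Sigma (Sigma ?U ?N) ?W)"
    by (rule bij_betw_same_card)
  have 2: "real (card (Sigma (Sigma ?U ?N) ?W)) =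
      real (card (Sigma ?U ?N)) * ((real CARD('f) - 1) * real CARD('f) ^ 2)"
    by (rule card_Sigma_const) (auto simp del: right_minus_eq intro!: card_linear_form_3)
  have 3: "real (card (Sigma ?U ?N)) = real (card ?U) * (real CARD('f) ^ 3 - real CARD('f))"
  proof (rule card_Sigma_const)
    fix u assume u: "u \<in> ?U"
    obtain u1 u2 u3 where u_eq: "u = (u1, u2, u3)" by (cases u)
    show "real (card (?N u)) = real CARD('f) ^ 3 - real CARD('f)"
      using u card_nonproportional[of u1 u2 u3] unfolding u_eq prod.case by blast
  qed auto
  show ?thesis by (simp only: 1 2 3 real_card_nonzero_triples)
qed

text \<open>
  The polynomial is the determinant of the matrix with rows \<open>(x, y, u)\<close>, \<open>(y, x, u)\<close>, \<open>(v, v, z)\<close>,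
  the general matrix invariant under swapping the first two indices. If 2 is invertible, \<open>x - y\<close> and
  \<open>x + y\<close> are independent coordinates and the second factor is a \<open>2 \<times> 2\<close> determinant. In
  characteristic 2 the two coincide and the product \<open>u v\<close> disappears; this is why the
  final count treats even \<open>q\<close> separately.
\<close>

lemma card_swap_invariant:
  "real (card {((x :: 'f::{field,finite}, y), (u, v, z)). (x - y) * ((x + y) * z - 2 * u * v) \<noteq> 0}) =
   (if (2 :: 'f) = 0 then real CARD('f) ^ 3 * (real CARD('f) - 1) ^ 2
    else (real CARD('f) - 1) * ((real CARD('f) ^ 2 - 1) * ((real CARD('f) - 1) * real CARD('f))))"
proof (cases "(2 :: 'f) = 0")
  case True
  have sum: "x + y = x - y" for x y :: 'f
  proof -
    have "x + y = x - y + 2 * y" by (simp add: algebra_simps)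
    then show ?thesis using True by simp
  qed
  have "{((x :: 'f, y), (u, v, z)). (x - y) * ((x + y) * z - 2 * u * v) \<noteq> 0} =
      {(x, y). 1 * x + (- 1) * y \<noteq> 0} \<times> (UNIV \<times> (UNIV \<times> {z. z \<noteq> 0}))"
    by (auto simp: True sum)
  then show ?thesis
    using True card_linear_form_2[of "1 :: 'f" "- 1"]
    by (simp add: card_cartesian_product real_card_nonzero power2_eq_square power3_eq_cube)
next
  case False
  have half: "(s + d) / 2 + (s - d) / 2 = s" "(s + d) / 2 - (s - d) / 2 = d"
    "(d + s + (d - s)) / 2 = d" "(d + s - (d - s)) / 2 = s" "2 * d / 2 = d" "2 * (d / 2) = d" for s d :: 'f
  proof -
    have eqs: "d + s + (d - s) = 2 * d" "d + s - (d - s) = 2 * s" "s + d - (s - d) = 2 * d" "s + d + (s - d) = 2 * s" by simp_all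
    show "(s + d) / 2 + (s - d) / 2 = s" "(s + d) / 2 - (s - d) / 2 = d"
      unfolding add_divide_distrib[symmetric] diff_divide_distrib[symmetric] eqs using False by simp_all
    show "(d + s + (d - s)) / 2 = d" "(d + s - (d - s)) / 2 = s"
      unfolding eqs using False by simp_all
    show "2 * d / 2 = d" "2 * (d / 2) = d" using False by simp_all
  qed
  have "bij_betw (\<lambda>((x, y), (u, v, z)). (x - y, ((x + y, 2 * u), (z, v))))
     {((x :: 'f, y), (u, v, z)). (x - y) * ((x + y) * z - 2 * u * v) \<noteq> 0}
     ({s. s \<noteq> 0} \<times> {((x, u), (y, v)). x * y - u * v \<noteq> 0})"
    by (rule bij_betw_byWitness[of _ "\<lambda>(d, ((s, u), (z, v))). (((s + d) / 2, (s - d) / 2), (u / 2, v, z))"])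
       (auto simp del: times_divide_eq_right times_divide_eq_left right_minus_eq simp: half)
  then show ?thesis
    using False card_nonsingular_2[where ?'f = 'f]
    by (simp add: bij_betw_same_card card_cartesian_product real_card_nonzero)
qed

text \<open>
  The form is \<open>v\<^sup>2 (t\<^sup>2 + t + 1)\<close> with \<open>t = u / v\<close>, and \<open>t\<^sup>2 + t + 1\<close> vanishes exactly at the nontrivial cube
  roots of unity, provided that 1 is not a root of it.
\<close>

lemma card_quadratic_form:
  assumes "(3 :: 'f::{field,finite}) \<noteq> 0"
  shows "real (card {(u :: 'f, v). u * u + u * v + v * v \<noteq> 0}) =
    real CARD('f) ^ 2 - 1 - (real CARD('f) - 1) * real (card {w :: 'f. w ^ 3 = 1 \<and> w \<noteq> 1})"
proof -
  let ?R = "{w :: 'f. w ^ 3 = 1 \<and> w \<noteq> 1}"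
  have R: "w \<in> ?R \<longleftrightarrow> w * w + w + 1 = 0" for w
  proof -
    have fac: "w ^ 3 - 1 = (w - 1) * (w * w + w + 1)" by (simp add: power3_eq_cube algebra_simps)
    have "w ^ 3 = 1 \<longleftrightarrow> w ^ 3 - 1 = 0" by simp
    also have "\<dots> \<longleftrightarrow> w = 1 \<or> w * w + w + 1 = 0" unfolding fac by simp
    finally show ?thesis using assms by auto
  qed
  have zero: "{(u, v). u * u + u * v + v * v = 0} = insert (0, 0) ((\<lambda>(w, v). (w * v, v)) ` (?R \<times> {v. v \<noteq> 0}))"
  proof (intro equalityI subsetI)
    fix t assume "t \<in> {(u, v). u * u + u * v + v * v = (0 :: 'f)}"
    then obtain u v where t: "t = (u, v)" and 0: "u * u + u * v + v * v = 0" by auto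
    show "t \<in> insert (0, 0) ((\<lambda>(w, v). (w * v, v)) ` (?R \<times> {v. v \<noteq> 0}))"
    proof (cases "v = 0")
      case True then show ?thesis using 0 t by simp
    next
      case False
      then have "u / v \<in> ?R" unfolding R using 0 by (simp add: field_simps)
      then show ?thesis using False t by (auto intro!: image_eqI[of _ _ "(u / v, v)"])
    qed
  next
    fix t assume t: "t \<in> insert (0, 0) ((\<lambda>(w, v). (w * v, v)) ` (?R \<times> {v. v \<noteq> 0}))"
    have "(w * v) * (w * v) + (w * v) * v + v * v = (w * w + w + 1) * (v * v)" for w v :: 'f
      by (simp add: algebra_simps)
    then show "t \<in> {(u, v). u * u + u * v + v * v = 0}" using t R by auto
  qed
  have "inj_on (\<lambda>(w :: 'f, v). (w * v, v)) (?R \<times> {v. v \<noteq> 0})" by (auto intro!: inj_onI)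
  then have "card ((\<lambda>(w :: 'f, v). (w * v, v)) ` (?R \<times> {v. v \<noteq> 0})) = card ?R * card {v :: 'f. v \<noteq> 0}"
    by (simp add: card_image card_cartesian_product)
  moreover have "(0, 0) \<notin> (\<lambda>(w :: 'f, v). (w * v, v)) ` (?R \<times> {v. v \<noteq> 0})" by auto
  ultimately have c: "real (card {(u, v). u * u + u * v + v * v = (0 :: 'f)}) = 1 + (real CARD('f) - 1) * real (card ?R)"
    unfolding zero by (simp add: real_card_nonzero)
  have eq: "{(u, v). u * u + u * v + v * v \<noteq> (0 :: 'f)} = UNIV - {(u, v). u * u + u * v + v * v = 0}" by auto
  have "card {(u, v). u * u + u * v + v * v = (0 :: 'f)} \<le> CARD('f \<times> 'f)" by (intro card_mono) auto
  moreover have "CARD('f \<times> 'f) = CARD('f) ^ 2" by (simp add: power2_eq_square card_cartesian_product flip: UNIV_Times_UNIV)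
  ultimately show ?thesis unfolding eq by (subst card_Diff_subset) (auto simp: of_nat_diff c)
qed

text \<open>
  The polynomial is the determinant of the circulant matrix with first row \<open>(x, y, z)\<close>. It is the product of
  \<open>x + y + z\<close> and a quadratic form in \<open>x - y\<close> and \<open>y - z\<close>. These three linear forms are independent
  unless the characteristic is 3, where the determinant degenerates to \<open>(x + y + z)\<^sup>3\<close>.
\<close>

lemma card_circulant:
  "real (card {(x :: 'f::{field,finite}, y, z). x ^ 3 + y ^ 3 + z ^ 3 - 3 * x * y * z \<noteq> 0}) =
   (if (3 :: 'f) = 0 then (real CARD('f) - 1) * real CARD('f) ^ 2
    else (real CARD('f) - 1) *
      (real CARD('f) ^ 2 - 1 - (real CARD('f) - 1) * real (card {w :: 'f. w ^ 3 = 1 \<and> w \<noteq> 1})))"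
proof (cases "(3 :: 'f) = 0")
  case True
  have "x ^ 3 + y ^ 3 + z ^ 3 - 3 * x * y * z = (1 * x + 1 * y + 1 * z) ^ 3" for x y z :: 'f
  proof -
    have "(1 * x + 1 * y + 1 * z) ^ 3 = x ^ 3 + y ^ 3 + z ^ 3 - 3 * x * y * z +
        3 * (x * x * y + x * x * z + y * y * x + y * y * z + z * z * x + z * z * y + 3 * x * y * z)"
      by (simp add: power3_eq_cube algebra_simps)
    then show ?thesis using True by simp
  qed
  then show ?thesis using True card_linear_form_3[of "1 :: 'f" 1 1] by simp
next
  case False
  have fac: "x ^ 3 + y ^ 3 + z ^ 3 - 3 * x * y * z =
      (x + y + z) * ((x - y) * (x - y) + (x - y) * (y - z) + (y - z) * (y - z))" for x y z :: 'f
    by (simp add: power3_eq_cube algebra_simps)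
  have third: "(x + y + z + 2 * (x - y) + (y - z)) / 3 = x" "(x + y + z - (x - y) + (y - z)) / 3 = y"
    "(x + y + z - (x - y) - 2 * (y - z)) / 3 = z" for x y z :: 'f
  proof -
    have eqs: "x + y + z + 2 * (x - y) + (y - z) = 3 * x" "x + y + z - (x - y) + (y - z) = 3 * y"
      "x + y + z - (x - y) - 2 * (y - z) = 3 * z" by (simp_all add: algebra_simps)
    show "(x + y + z + 2 * (x - y) + (y - z)) / 3 = x" "(x + y + z - (x - y) + (y - z)) / 3 = y"
      "(x + y + z - (x - y) - 2 * (y - z)) / 3 = z"
      unfolding eqs using False by simp_all
  qed
  have third': "(s + 2 * u + v) / 3 + (s - u + v) / 3 + (s - u - 2 * v) / 3 = s"
    "(s + 2 * u + v) / 3 - (s - u + v) / 3 = u" "(s - u + v) / 3 - (s - u - 2 * v) / 3 = v" for s u v :: 'f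
  proof -
    have eqs: "s + 2 * u + v + (s - u + v) + (s - u - 2 * v) = 3 * s" "s + 2 * u + v - (s - u + v) = 3 * u"
      "s - u + v - (s - u - 2 * v) = 3 * v" by (simp_all add: algebra_simps)
    show "(s + 2 * u + v) / 3 + (s - u + v) / 3 + (s - u - 2 * v) / 3 = s"
      "(s + 2 * u + v) / 3 - (s - u + v) / 3 = u" "(s - u + v) / 3 - (s - u - 2 * v) / 3 = v"
      unfolding add_divide_distrib[symmetric] diff_divide_distrib[symmetric] eqs using False by simp_all
  qed
  have "bij_betw (\<lambda>(x, y, z). (x + y + z, (x - y, y - z)))
      {(x :: 'f, y, z). x ^ 3 + y ^ 3 + z ^ 3 - 3 * x * y * z \<noteq> 0}
      ({s. s \<noteq> 0} \<times> {(u, v). u * u + u * v + v * v \<noteq> 0})"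
    unfolding fac
    by (rule bij_betw_byWitness[of _ "\<lambda>(s, (u, v)). ((s + 2 * u + v) / 3, (s - u + v) / 3, (s - u - 2 * v) / 3)"])
       (auto simp: False third third')
  then show ?thesis
    using False
    by (simp add: bij_betw_same_card card_cartesian_product real_card_nonzero card_quadratic_form)
qed

section \<open>Fixed matrices of a monomial transformation\<close>

text \<open>
  The nonsingular matrices fixed by \<open>(a, \<sigma>)\<close>, with denominators cleared.
\<close>

definition fixed_matrices :: "('n::finite \<Rightarrow> 'f::field) \<Rightarrow> ('n \<Rightarrow> 'n) \<Rightarrow> ('f ^ 'n ^ 'n) set" where
  "fixed_matrices a \<sigma> = {A. det A \<noteq> 0 \<and> (\<forall>r c. A $ r $ c * (a c)\<^sup>2 = a r * A $ \<sigma> r $ \<sigma> c)}"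

lemma invariants_eq_fixed_matrices:
  fixes a :: "'n::finite \<Rightarrow> 'f::field"
  assumes "\<And>i. a i \<noteq> 0"
  shows "invariants {A :: 'f ^ 'n ^ 'n. invertible A} (\<lambda>g. restrict (monomial_act g) {A. invertible A}) (a, \<sigma>) =
         fixed_matrices a \<sigma>"
proof -
  have "a r * A $ \<sigma> r $ \<sigma> c / (a c)\<^sup>2 = A $ r $ c \<longleftrightarrow> A $ r $ c * (a c)\<^sup>2 = a r * A $ \<sigma> r $ \<sigma> c"
    for A :: "'f ^ 'n ^ 'n" and r c
    using assms[of c] by (auto simp: divide_eq_eq)
  then show ?thesis
    by (simp add: invariants_def fixed_matrices_def monomial_act_def vec_eq_iff invertible_det_nz cong: conj_cong)
qed

lemma card_nonvanishing_functions:
  "real (card {a :: 'n::finite \<Rightarrow> 'f::{field,finite}. \<forall>i. a i \<noteq> 0}) = (real CARD('f) - 1) ^ CARD('n)"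
proof -
  have "{a :: 'n \<Rightarrow> 'f. \<forall>i. a i \<noteq> 0} = PiE UNIV (\<lambda>_. {x. x \<noteq> 0})" by (auto simp: PiE_def Pi_def extensional_def)
  then show ?thesis by (simp add: card_PiE real_card_nonzero)
qed

section \<open>Permutations of three indices\<close>

lemma distinct_indices_3:
  fixes i j k r :: 3
  assumes "i \<noteq> j" "i \<noteq> k" "j \<noteq> k"
  shows "r = i \<or> r = j \<or> r = k"
  using assms exhaust_3[of i] exhaust_3[of j] exhaust_3[of k] exhaust_3[of r] by auto

lemma all_indices_3:
  fixes i j k :: 3
  assumes "i \<noteq> j" "i \<noteq> k" "j \<noteq> k"
  shows "(\<forall>r. P r) \<longleftrightarrow> P i \<and> P j \<and> P k"
  using distinct_indices_3[OF assms] by metis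

lemma det_indices_3:
  fixes A :: "'f::comm_ring_1 ^ 3 ^ 3"
  assumes "i \<noteq> j" "i \<noteq> k" "j \<noteq> k"
  shows "det A = A$i$i * A$j$j * A$k$k + A$i$j * A$j$k * A$k$i + A$i$k * A$j$i * A$k$j -
      A$i$i * A$j$k * A$k$j - A$i$j * A$j$i * A$k$k - A$i$k * A$j$j * A$k$i"
  using exhaust_3[of i] exhaust_3[of j] exhaust_3[of k] assms
  by (elim disjE) (simp_all add: det_3 algebra_simps)

lemma other_indices_3:
  fixes k :: 3
  obtains i j where "i \<noteq> j" "i \<noteq> k" "j \<noteq> k"
proof -
  consider "k = 1" | "k = 2" | "k = 3" using exhaust_3[of k] by blast
  then show thesis by cases (auto intro: that[of 2 3] that[of 1 3] that[of 1 2])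
qed

text \<open>
  The cycle types of the symmetric group on three letters: a permutation with a fixed point either fixes or swaps the
  other two indices, and a permutation without one is a three-cycle.
\<close>

lemma permutation_3_cases:
  fixes \<pi> :: "3 \<Rightarrow> 3"
  assumes "bij \<pi>"
  obtains (identity) "\<pi> = id"
  | (transposition) i j k where "i \<noteq> j" "i \<noteq> k" "j \<noteq> k" "\<pi> = Transposition.transpose i j"
  | (cycle) i j k where "i \<noteq> j" "i \<noteq> k" "j \<noteq> k" "\<pi> i = j" "\<pi> j = k" "\<pi> k = i"
proof (cases "\<exists>k. \<pi> k = k")
  case True
  then obtain k where k: "\<pi> k = k" ..
  obtain i j where ij: "i \<noteq> j" "i \<noteq> k" "j \<noteq> k" by (rule other_indices_3)
  have inj: "\<pi> x = \<pi> y \<Longrightarrow> x = y" for x y using assms by (auto simp: bij_def inj_eq)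
  have "\<pi> i \<noteq> k" "\<pi> j \<noteq> k" "\<pi> i \<noteq> \<pi> j" using inj k ij by metis+
  then have "\<pi> i = i \<and> \<pi> j = j \<or> \<pi> i = j \<and> \<pi> j = i"
    using distinct_indices_3[OF ij, of "\<pi> i"] distinct_indices_3[OF ij, of "\<pi> j"] by auto
  then show thesis
  proof
    assume "\<pi> i = i \<and> \<pi> j = j"
    then have "\<pi> = id" using k all_indices_3[OF ij, of "\<lambda>r. \<pi> r = r"] by (auto simp: fun_eq_iff)
    then show thesis by (rule identity)
  next
    assume "\<pi> i = j \<and> \<pi> j = i"
    then have "\<pi> = Transposition.transpose i j"
      using k ij all_indices_3[OF ij, of "\<lambda>r. \<pi> r = Transposition.transpose i j r"] by (auto simp: fun_eq_iff)
    then show thesis using ij by (intro transposition)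
  qed
next
  case False
  have inj: "\<pi> x = \<pi> y \<Longrightarrow> x = y" for x y using assms by (auto simp: bij_def inj_eq)
  let ?j = "\<pi> 1" and ?k = "\<pi> (\<pi> 1)"
  have d: "1 \<noteq> ?j" "?j \<noteq> ?k" using False by metis+
  show thesis
  proof (cases "1 = ?k")
    case True
    obtain r where r: "r \<noteq> 1" "r \<noteq> ?j" by (metis other_indices_3)
    have "\<pi> r = r"
      using distinct_indices_3[of 1 ?j r "\<pi> r"] r d inj True by metis
    then show thesis using False by blast
  next
    case ne: False
    have "\<pi> ?k = 1"
      using distinct_indices_3[of 1 ?j ?k "\<pi> ?k"] ne d inj False by metis
    then show thesis using cycle[of 1 ?j ?k] ne d by auto
  qed
qed

text \<open>
  Fixed point counts depend only on the cycle type; there are three transpositions and two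
  three-cycles.
\<close>

lemma sum_permutations_3:
  fixes F :: "(3 \<Rightarrow> 3) \<Rightarrow> real"
  assumes id: "F id = A"
    and transposition: "\<And>i j k. i \<noteq> j \<Longrightarrow> i \<noteq> k \<Longrightarrow> j \<noteq> k \<Longrightarrow> F (Transposition.transpose i j) = B"
    and cycle: "\<And>i j k \<sigma>. i \<noteq> j \<Longrightarrow> i \<noteq> k \<Longrightarrow> j \<noteq> k \<Longrightarrow> \<sigma> i = j \<Longrightarrow> \<sigma> j = k \<Longrightarrow> \<sigma> k = i \<Longrightarrow> F \<sigma> = C"
  shows "(\<Sum>\<sigma> | bij \<sigma>. F \<sigma>) = A + 3 * B + 2 * C"
proof -
  have f123: "finite {2::3, 3}" "1 \<notin> {2::3, 3}" and f23: "finite {3::3}" "2 \<notin> {3::3}"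
    by auto
  have eq: "{\<sigma> :: 3 \<Rightarrow> 3. bij \<sigma>} = {\<sigma>. \<sigma> permutes insert 1 {2, 3}}"
    by (simp add: permutes_univ bij_iff flip: UNIV_3)
  have "(\<Sum>\<sigma> | bij \<sigma>. F \<sigma>) = F id + F (Transposition.transpose 2 3) + F (Transposition.transpose 1 2) +
      F (Transposition.transpose 1 2 \<circ> Transposition.transpose 2 3) + F (Transposition.transpose 1 3) + F (Transposition.transpose 1 3 \<circ> Transposition.transpose 2 3)"
    unfolding eq sum_over_permutations_insert[OF f123] sum_over_permutations_insert[OF f23] permutes_sing
    by simp
  moreover have "F (Transposition.transpose 1 2 \<circ> Transposition.transpose 2 3) = C"
    by (rule cycle[of 1 2 3]) (auto simp: Transposition.transpose_def)
  moreover have "F (Transposition.transpose 1 3 \<circ> Transposition.transpose 2 3) = C"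
    by (rule cycle[of 1 3 2]) (auto simp: Transposition.transpose_def)
  moreover have "F (Transposition.transpose 2 3) = B" by (rule transposition[of 2 3 1]) auto
  moreover have "F (Transposition.transpose 1 2) = B" by (rule transposition[of 1 2 3]) auto
  moreover have "F (Transposition.transpose 1 3) = B" by (rule transposition[of 1 3 2]) auto
  ultimately show ?thesis using id by simp
qed

text \<open>
  Rows and columns are listed in the order \<open>i\<close>, \<open>j\<close>, \<open>k\<close>, so that one computation covers all
  permutations of a given cycle type.
\<close>

definition matrix_3 :: "3 \<Rightarrow> 3 \<Rightarrow> 3 \<Rightarrow> 'a \<times> 'a \<times> 'a \<Rightarrow> 'a \<times> 'a \<times> 'a \<Rightarrow> 'a \<times> 'a \<times> 'a \<Rightarrow> 'a ^ 3 ^ 3" where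
  "matrix_3 i j k R1 R2 R3 = (\<chi> r c. case (if r = i then R1 else if r = j then R2 else R3) of
     (x, y, z) \<Rightarrow> if c = i then x else if c = j then y else z)"

section \<open>Matrices fixed over a transposition\<close>

text \<open>
  A matrix fixed by \<open>(a, \<sigma>)\<close> has its entries linked along the orbits of \<open>\<sigma>\<close> on index pairs. Running once
  round an orbit multiplies an entry by a constant, so the entry vanishes unless that
  constant is 1.
\<close>

lemma cyclic_scaling:
  fixes x :: "'a::comm_ring_1"
  assumes "x * p = u * y" "y * q = v * z" "z * r = w * x"
  shows "x * (p * q * r) = x * (u * v * w)"
proof -
  have "x * (p * q * r) = (x * p) * (q * r)" by (simp add: mult_ac)
  also have "\<dots> = u * r * (y * q)" unfolding assms(1) by (simp add: mult_ac)
  also have "\<dots> = u * v * (z * r)" unfolding assms(2) by (simp add: mult_ac)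
  also have "\<dots> = x * (u * v * w)" unfolding assms(3) by (simp add: mult_ac)
  finally show ?thesis .
qed

lemma swap_scaling:
  fixes x :: "'a::comm_ring_1"
  assumes "x * p = u * y" "y * q = v * x"
  shows "x * (p * q) = x * (u * v)"
  using cyclic_scaling[OF assms, of 1 1] by simp

text \<open>
  Put \<open>\<alpha> = a\<^sub>i\<close>, \<open>\<beta> = a\<^sub>j\<close>, \<open>\<gamma> = a\<^sub>k\<close>. If \<open>\<alpha>\<beta> \<noteq> 1\<close> the whole block on \<open>i\<close>, \<open>j\<close> vanishes; if
  \<open>\<alpha>\<beta> = 1\<close> and \<open>\<gamma> \<noteq> 1\<close> the entry at \<open>(k, k)\<close> vanishes. Either way the matrix is singular. In the remaining
  case a diagonal change of basis makes all three coefficients 1, so that the fixed matrices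
  correspond to those invariant under the plain swap.
\<close>

lemma card_fixed_matrices_transposition:
  fixes a :: "3 \<Rightarrow> 'f::{field,finite}"
  assumes ijk: "i \<noteq> j" "i \<noteq> k" "j \<noteq> k" and a: "\<And>r. a r \<noteq> 0"
  shows "card (fixed_matrices a (Transposition.transpose i j)) =
    (if a i * a j = 1 \<and> a k = 1
     then card {((x :: 'f, y), (u, v, z)). (x - y) * ((x + y) * z - 2 * u * v) \<noteq> 0} else 0)"
proof -
  let ?\<alpha> = "a i" and ?\<beta> = "a j" and ?\<gamma> = "a k"
  note a' = a[of i] a[of j] a[of k]
  have t: "Transposition.transpose i j i = j" "Transposition.transpose i j j = i" "Transposition.transpose i j k = k" using ijk by (auto simp: Transposition.transpose_def)
  have fixed: "A \<in> fixed_matrices a (Transposition.transpose i j) \<longleftrightarrow> det A \<noteq> 0 \<and>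
      A$i$i * ?\<alpha>\<^sup>2 = ?\<alpha> * A$j$j \<and> A$i$j * ?\<beta>\<^sup>2 = ?\<alpha> * A$j$i \<and> A$i$k * ?\<gamma>\<^sup>2 = ?\<alpha> * A$j$k \<and>
      A$j$i * ?\<alpha>\<^sup>2 = ?\<beta> * A$i$j \<and> A$j$j * ?\<beta>\<^sup>2 = ?\<beta> * A$i$i \<and> A$j$k * ?\<gamma>\<^sup>2 = ?\<beta> * A$i$k \<and>
      A$k$i * ?\<alpha>\<^sup>2 = ?\<gamma> * A$k$j \<and> A$k$j * ?\<beta>\<^sup>2 = ?\<gamma> * A$k$i \<and> A$k$k * ?\<gamma>\<^sup>2 = ?\<gamma> * A$k$k" for A
    unfolding fixed_matrices_def by (simp add: all_indices_3[OF ijk] t conj_assoc)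
  have cond: "?\<alpha> * ?\<beta> = 1 \<and> ?\<gamma> = 1" if A: "A \<in> fixed_matrices a (Transposition.transpose i j)" for A
  proof (rule ccontr)
    assume neg: "\<not> (?\<alpha> * ?\<beta> = 1 \<and> ?\<gamma> = 1)"
    from A have det: "det A \<noteq> 0"
      and e: "A$i$i * ?\<alpha>\<^sup>2 = ?\<alpha> * A$j$j" "A$i$j * ?\<beta>\<^sup>2 = ?\<alpha> * A$j$i" "A$i$k * ?\<gamma>\<^sup>2 = ?\<alpha> * A$j$k"
        "A$j$i * ?\<alpha>\<^sup>2 = ?\<beta> * A$i$j" "A$j$j * ?\<beta>\<^sup>2 = ?\<beta> * A$i$i" "A$j$k * ?\<gamma>\<^sup>2 = ?\<beta> * A$i$k"
        "A$k$i * ?\<alpha>\<^sup>2 = ?\<gamma> * A$k$j" "A$k$j * ?\<beta>\<^sup>2 = ?\<gamma> * A$k$i" "A$k$k * ?\<gamma>\<^sup>2 = ?\<gamma> * A$k$k"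
      unfolding fixed by blast+
    show False
    proof (cases "?\<alpha> * ?\<beta> = 1")
      case False
      have vanish: "x = 0" if "x * (?\<alpha> * ?\<beta>)\<^sup>2 = x * (?\<alpha> * ?\<beta>)" for x
        using that False a' by (simp add: power2_eq_square)
      have "A$i$i = 0" using swap_scaling[OF e(1,5)] by (intro vanish) (simp add: power_mult_distrib)
      moreover have "A$j$j = 0" using swap_scaling[OF e(5,1)] by (intro vanish) (simp add: power_mult_distrib mult_ac)
      moreover have "A$i$j = 0" using swap_scaling[OF e(2,4)] by (intro vanish) (simp add: power_mult_distrib mult_ac)
      moreover have "A$j$i = 0" using swap_scaling[OF e(4,2)] by (intro vanish) (simp add: power_mult_distrib mult_ac)
      ultimately have "A$i$i = 0" "A$i$j = 0" "A$j$i = 0" "A$j$j = 0" by simp_all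
      then show False using det by (simp add: det_indices_3[OF ijk])
    next
      case ab: True
      then have g: "?\<gamma> \<noteq> 1" using neg by simp
      then have kk: "A$k$k = 0" using e(9) a' by (simp add: power2_eq_square)
      have b: "?\<beta> = 1 / ?\<alpha>" using ab a' by (simp add: field_simps)
      have jk: "A$j$k = ?\<beta> * ?\<gamma>\<^sup>2 * A$i$k" using e(3) a' unfolding b by (simp add: field_simps power2_eq_square power3_eq_cube)
      have jj: "A$j$j = ?\<alpha> * A$i$i" using e(1) a' by (simp add: field_simps power2_eq_square power3_eq_cube)
      have ji: "A$j$i = ?\<beta> ^ 3 * A$i$j" using e(2) a' unfolding b by (simp add: field_simps power2_eq_square power3_eq_cube)
      have ki: "A$k$i * (?\<gamma> - 1) * (?\<gamma> + 1) = 0"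
        using swap_scaling[OF e(7,8)] ab by (simp add: power_mult_distrib[symmetric] algebra_simps)
      \<comment> \<open>If \<open>\<gamma> = -1\<close>, the four terms of the determinant cancel in pairs; otherwise row \<open>k\<close> vanishes.\<close>
      show False
      proof (cases "?\<gamma> = - 1")
        case True
        have "A$k$j = - (A$k$i * ?\<alpha>\<^sup>2)" using e(7) True by simp
        then have kj: "A$k$j = - (?\<alpha>\<^sup>2) * A$k$i" by (simp add: mult.commute)
        have jk: "A$j$k = ?\<beta> * A$i$k" using jk True by simp
        have "det A = 0" unfolding det_indices_3[OF ijk] kk jk jj ji kj b
          using a' by (simp add: field_simps power2_eq_square power3_eq_cube)
        then show False using det by simp
      next
        case False
        then have "A$k$i = 0" using ki g by (auto simp: eq_neg_iff_add_eq_0)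
        moreover from this have "A$k$j = 0" using e(7) a' by simp
        ultimately show False using det kk by (simp add: det_indices_3[OF ijk])
      qed
    qed
  qed
  show ?thesis
  proof (cases "?\<alpha> * ?\<beta> = 1 \<and> ?\<gamma> = 1")
    case False
    then have "fixed_matrices a (Transposition.transpose i j) = {}" using cond by blast
    then show ?thesis by (simp only: False if_False card.empty)
  next
    case True
    then have b: "?\<beta> = 1 / ?\<alpha>" and g: "?\<gamma> = 1" using a' by (simp_all add: field_simps)
    \<comment> \<open>The power of \<open>\<alpha>\<close> at \<open>y\<close> is chosen so that the determinant is the swap-invariant one up to a unit factor.\<close>
    let ?M = "\<lambda>((x, y), (u, v, z)). matrix_3 i j k
      (x, ?\<alpha>\<^sup>2 * y, u) (?\<beta> * y, ?\<alpha> * x, ?\<beta> * u) (v, ?\<alpha>\<^sup>2 * v, z)"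
    let ?f = "\<lambda>A :: 'f ^ 3 ^ 3. ((A$i$i, ?\<beta>\<^sup>2 * A$i$j), (A$i$k, A$k$i, A$k$k))"
    let ?T = "{((x :: 'f, y), (u, v, z)). (x - y) * ((x + y) * z - 2 * u * v) \<noteq> 0}"
    have det_M: "det (?M ((x, y), (u, v, z))) = ?\<alpha> * ((x - y) * ((x + y) * z - 2 * u * v))" for x y u v z
      unfolding det_indices_3[OF ijk] b using ijk a'
      by (simp add: matrix_3_def field_simps power2_eq_square)
    have M_f: "?M (?f A) = A" if "A \<in> fixed_matrices a (Transposition.transpose i j)" for A
    proof -
      from that have e: "A$i$i * ?\<alpha>\<^sup>2 = ?\<alpha> * A$j$j" "A$i$j * ?\<beta>\<^sup>2 = ?\<alpha> * A$j$i"
        "A$i$k * ?\<gamma>\<^sup>2 = ?\<alpha> * A$j$k" "A$k$i * ?\<alpha>\<^sup>2 = ?\<gamma> * A$k$j"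
        unfolding fixed by blast+
      have "A$j$j = ?\<alpha> * A$i$i" using e(1) a' by (simp add: field_simps power2_eq_square power3_eq_cube)
      moreover have "A$j$i = ?\<beta> * (?\<beta>\<^sup>2 * A$i$j)" using e(2) a' unfolding b by (simp add: field_simps power2_eq_square power3_eq_cube)
      moreover have "A$j$k = ?\<beta> * A$i$k" using e(3) a' unfolding b g by (simp add: field_simps power2_eq_square power3_eq_cube)
      moreover have "A$k$j = ?\<alpha>\<^sup>2 * A$k$i" using e(4) unfolding g by (simp add: mult.commute)
      moreover have "A$i$j = ?\<alpha>\<^sup>2 * (?\<beta>\<^sup>2 * A$i$j)" using a' unfolding b by (simp add: field_simps power2_eq_square power3_eq_cube)
      ultimately show ?thesis using ijk by (simp add: vec_eq_iff matrix_3_def all_indices_3[OF ijk])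
    qed
    have f_M: "?f (?M t) = t" for t
    proof -
      obtain x y u v z where t: "t = ((x, y), (u, v, z))" by (metis surj_pair)
      have "?\<beta>\<^sup>2 * (?\<alpha>\<^sup>2 * y) = y" using a' unfolding b by (simp add: field_simps power2_eq_square power3_eq_cube)
      then show ?thesis using ijk by (simp add: t matrix_3_def)
    qed
    have "bij_betw ?f (fixed_matrices a (Transposition.transpose i j)) ?T"
    proof (rule bij_betw_byWitness[of _ ?M])
      show "\<forall>A\<in>fixed_matrices a (Transposition.transpose i j). ?M (?f A) = A" using M_f by blast
      show "\<forall>t\<in>?T. ?f (?M t) = t" using f_M by blast
      show "?f ` fixed_matrices a (Transposition.transpose i j) \<subseteq> ?T"
      proof
        fix t assume "t \<in> ?f ` fixed_matrices a (Transposition.transpose i j)"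
        then obtain A where A: "A \<in> fixed_matrices a (Transposition.transpose i j)" "t = ?f A" by blast
        then have "det (?M t) \<noteq> 0" using M_f fixed by simp
        then show "t \<in> ?T" using det_M unfolding A(2) by simp
      qed
      show "?M ` ?T \<subseteq> fixed_matrices a (Transposition.transpose i j)"
      proof
        fix B assume "B \<in> ?M ` ?T"
        then obtain x y u v z where B: "B = ?M ((x, y), (u, v, z))"
          and ne: "(x - y) * ((x + y) * z - 2 * u * v) \<noteq> 0" by blast
        have "det B \<noteq> 0" unfolding B det_M using ne a' by simp
        moreover have "x * ?\<alpha>\<^sup>2 = ?\<alpha> * (?\<alpha> * x)" "?\<alpha>\<^sup>2 * y * ?\<beta>\<^sup>2 = ?\<alpha> * (?\<beta> * y)"
          "u * ?\<gamma>\<^sup>2 = ?\<alpha> * (?\<beta> * u)" "?\<beta> * y * ?\<alpha>\<^sup>2 = ?\<beta> * (?\<alpha>\<^sup>2 * y)" "?\<alpha> * x * ?\<beta>\<^sup>2 = ?\<beta> * x"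
          "?\<beta> * u * ?\<gamma>\<^sup>2 = ?\<beta> * u" "v * ?\<alpha>\<^sup>2 = ?\<gamma> * (?\<alpha>\<^sup>2 * v)" "?\<alpha>\<^sup>2 * v * ?\<beta>\<^sup>2 = ?\<gamma> * v" "z * ?\<gamma>\<^sup>2 = ?\<gamma> * z"
          using a' unfolding b g by (simp_all add: field_simps power2_eq_square)
        moreover have "B$i$i = x" "B$i$j = ?\<alpha>\<^sup>2 * y" "B$i$k = u" "B$j$i = ?\<beta> * y" "B$j$j = ?\<alpha> * x" "B$j$k = ?\<beta> * u"
          "B$k$i = v" "B$k$j = ?\<alpha>\<^sup>2 * v" "B$k$k = z"
          using ijk by (simp_all add: B matrix_3_def)
        ultimately show "B \<in> fixed_matrices a (Transposition.transpose i j)" unfolding fixed by simp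
      qed
    qed
    then show ?thesis using True by (simp add: bij_betw_same_card)
  qed
qed

lemma card_coefficients_transposition:
  fixes i j k :: 3
  assumes ijk: "i \<noteq> j" "i \<noteq> k" "j \<noteq> k"
  shows "real (card {a :: 3 \<Rightarrow> 'f::{field,finite}. (\<forall>r. a r \<noteq> 0) \<and> a i * a j = 1 \<and> a k = 1}) = real CARD('f) - 1"
proof -
  have "bij_betw (\<lambda>a. a i) {a :: 3 \<Rightarrow> 'f. (\<forall>r. a r \<noteq> 0) \<and> a i * a j = 1 \<and> a k = 1} {x. x \<noteq> 0}"
    by (rule bij_betw_byWitness[of _ "\<lambda>x r. if r = i then x else if r = j then 1 / x else 1"])
       (use ijk in \<open>auto simp: fun_eq_iff all_indices_3[OF ijk] field_simps\<close>)
  then show ?thesis by (simp add: bij_betw_same_card real_card_nonzero)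
qed

section \<open>Matrices fixed over a three-cycle\<close>

text \<open>
  All orbits on index pairs have length three, and running round any of them multiplies an entry by the product
  of the three coefficients. So either every entry vanishes, or this product is 1 and a diagonal change of basis turns the
  fixed matrices into circulant ones.
\<close>

lemma card_fixed_matrices_cycle:
  fixes a :: "3 \<Rightarrow> 'f::{field,finite}"
  assumes ijk: "i \<noteq> j" "i \<noteq> k" "j \<noteq> k" and \<sigma>: "\<sigma> i = j" "\<sigma> j = k" "\<sigma> k = i" and a: "\<And>r. a r \<noteq> 0"
  shows "card (fixed_matrices a \<sigma>) =
    (if a i * a j * a k = 1
     then card {(x :: 'f, y, z). x ^ 3 + y ^ 3 + z ^ 3 - 3 * x * y * z \<noteq> 0} else 0)"
proof -
  let ?\<alpha> = "a i" and ?\<beta> = "a j" and ?\<gamma> = "a k"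
  note a' = a[of i] a[of j] a[of k]
  have fixed: "A \<in> fixed_matrices a \<sigma> \<longleftrightarrow> det A \<noteq> 0 \<and>
      A$i$i * ?\<alpha>\<^sup>2 = ?\<alpha> * A$j$j \<and> A$i$j * ?\<beta>\<^sup>2 = ?\<alpha> * A$j$k \<and> A$i$k * ?\<gamma>\<^sup>2 = ?\<alpha> * A$j$i \<and>
      A$j$i * ?\<alpha>\<^sup>2 = ?\<beta> * A$k$j \<and> A$j$j * ?\<beta>\<^sup>2 = ?\<beta> * A$k$k \<and> A$j$k * ?\<gamma>\<^sup>2 = ?\<beta> * A$k$i \<and>
      A$k$i * ?\<alpha>\<^sup>2 = ?\<gamma> * A$i$j \<and> A$k$j * ?\<beta>\<^sup>2 = ?\<gamma> * A$i$k \<and> A$k$k * ?\<gamma>\<^sup>2 = ?\<gamma> * A$i$i" for A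
    unfolding fixed_matrices_def by (simp add: all_indices_3[OF ijk] \<sigma> conj_assoc)
  have cond: "?\<alpha> * ?\<beta> * ?\<gamma> = 1" if A: "A \<in> fixed_matrices a \<sigma>" for A
  proof (rule ccontr)
    assume neg: "?\<alpha> * ?\<beta> * ?\<gamma> \<noteq> 1"
    from A have det: "det A \<noteq> 0"
      and e: "A$i$i * ?\<alpha>\<^sup>2 = ?\<alpha> * A$j$j" "A$i$j * ?\<beta>\<^sup>2 = ?\<alpha> * A$j$k" "A$i$k * ?\<gamma>\<^sup>2 = ?\<alpha> * A$j$i"
        "A$j$i * ?\<alpha>\<^sup>2 = ?\<beta> * A$k$j" "A$j$j * ?\<beta>\<^sup>2 = ?\<beta> * A$k$k" "A$j$k * ?\<gamma>\<^sup>2 = ?\<beta> * A$k$i"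
        "A$k$i * ?\<alpha>\<^sup>2 = ?\<gamma> * A$i$j" "A$k$j * ?\<beta>\<^sup>2 = ?\<gamma> * A$i$k" "A$k$k * ?\<gamma>\<^sup>2 = ?\<gamma> * A$i$i"
      unfolding fixed by blast+
    have vanish: "x = 0" if "x * (?\<alpha> * ?\<beta> * ?\<gamma>)\<^sup>2 = x * (?\<alpha> * ?\<beta> * ?\<gamma>)" for x
      using that neg a' by (simp add: power2_eq_square)
    have "A$i$i = 0" using cyclic_scaling[OF e(1,5,9)] by (intro vanish) (simp add: power_mult_distrib mult_ac)
    moreover have "A$i$j = 0" using cyclic_scaling[OF e(2,6,7)] by (intro vanish) (simp add: power_mult_distrib mult_ac)
    moreover have "A$i$k = 0" using cyclic_scaling[OF e(3,4,8)] by (intro vanish) (simp add: power_mult_distrib mult_ac)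
    ultimately have "A$i$i = 0" "A$i$j = 0" "A$i$k = 0" by simp_all
    then show False using det by (simp add: det_indices_3[OF ijk])
  qed
  show ?thesis
  proof (cases "?\<alpha> * ?\<beta> * ?\<gamma> = 1")
    case False
    then have "fixed_matrices a \<sigma> = {}" using cond by blast
    then show ?thesis by (simp only: False if_False card.empty)
  next
    case abg: True
    then have c: "?\<gamma> = 1 / (?\<alpha> * ?\<beta>)" using a' by (simp add: field_simps)
    \<comment> \<open>The powers of \<open>\<alpha>\<close> and \<open>\<beta>\<close> in the first row make the determinant the circulant one up to a unit factor.\<close>
    let ?M = "\<lambda>(x, y, z). matrix_3 i j k
      (x, ?\<alpha>\<^sup>2 * y, ?\<alpha>\<^sup>2 * ?\<beta>\<^sup>2 * z) (?\<beta> * ?\<gamma> * z, ?\<alpha> * x, ?\<alpha> * ?\<beta>\<^sup>2 * y) (?\<gamma> * y, ?\<alpha>\<^sup>2 * ?\<gamma> * z, ?\<alpha> * ?\<beta> * x)"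
    let ?f = "\<lambda>A :: 'f ^ 3 ^ 3. (A$i$i, ?\<beta>\<^sup>2 * ?\<gamma>\<^sup>2 * A$i$j, ?\<gamma>\<^sup>2 * A$i$k)"
    let ?T = "{(x :: 'f, y, z). x ^ 3 + y ^ 3 + z ^ 3 - 3 * x * y * z \<noteq> 0}"
    have det_M: "det (?M (x, y, z)) = ?\<alpha>\<^sup>2 * ?\<beta> * (x ^ 3 + y ^ 3 + z ^ 3 - 3 * x * y * z)" for x y z
      unfolding det_indices_3[OF ijk] c using ijk a'
      by (simp add: matrix_3_def field_simps power2_eq_square power3_eq_cube)
    have M_f: "?M (?f A) = A" if "A \<in> fixed_matrices a \<sigma>" for A
    proof -
      from that have e: "A$i$i * ?\<alpha>\<^sup>2 = ?\<alpha> * A$j$j" "A$i$j * ?\<beta>\<^sup>2 = ?\<alpha> * A$j$k" "A$i$k * ?\<gamma>\<^sup>2 = ?\<alpha> * A$j$i"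
        "A$j$i * ?\<alpha>\<^sup>2 = ?\<beta> * A$k$j" "A$j$j * ?\<beta>\<^sup>2 = ?\<beta> * A$k$k" "A$j$k * ?\<gamma>\<^sup>2 = ?\<beta> * A$k$i"
        unfolding fixed by blast+
      have 1: "A$j$j = ?\<alpha> * A$i$i" using e(1) a' unfolding c by (simp add: field_simps power2_eq_square power3_eq_cube)
      have "A$k$k = ?\<beta> * A$j$j" using e(5) a' by (simp add: field_simps power2_eq_square)
      then have 2: "A$k$k = ?\<alpha> * ?\<beta> * A$i$i" using 1 by simp
      have 3: "A$i$j = ?\<alpha>\<^sup>2 * (?\<beta>\<^sup>2 * ?\<gamma>\<^sup>2 * A$i$j)" using a' unfolding c by (simp add: field_simps power2_eq_square power3_eq_cube)
      have 4: "A$j$k = ?\<alpha> * ?\<beta>\<^sup>2 * (?\<beta>\<^sup>2 * ?\<gamma>\<^sup>2 * A$i$j)" using e(2) a' unfolding c by (simp add: field_simps power2_eq_square power3_eq_cube)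
      have 5: "A$k$i = ?\<gamma> * (?\<beta>\<^sup>2 * ?\<gamma>\<^sup>2 * A$i$j)" using e(2,6) a' unfolding c by (simp add: field_simps power2_eq_square power3_eq_cube)
      have 6: "A$i$k = ?\<alpha>\<^sup>2 * ?\<beta>\<^sup>2 * (?\<gamma>\<^sup>2 * A$i$k)" using a' unfolding c by (simp add: field_simps power2_eq_square power3_eq_cube)
      have 7: "A$j$i = ?\<beta> * ?\<gamma> * (?\<gamma>\<^sup>2 * A$i$k)" using e(3) a' unfolding c by (simp add: field_simps power2_eq_square power3_eq_cube)
      have 8: "A$k$j = ?\<alpha>\<^sup>2 * ?\<gamma> * (?\<gamma>\<^sup>2 * A$i$k)" using e(3,4) a' unfolding c by (simp add: field_simps power2_eq_square power3_eq_cube)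
      show ?thesis using ijk 1 2 3 4 5 6 7 8 by (simp add: vec_eq_iff matrix_3_def all_indices_3[OF ijk])
    qed
    have f_M: "?f (?M t) = t" for t
    proof -
      obtain x y z where t: "t = (x, y, z)" by (metis surj_pair)
      have "?\<beta>\<^sup>2 * ?\<gamma>\<^sup>2 * (?\<alpha>\<^sup>2 * y) = y" "?\<gamma>\<^sup>2 * (?\<alpha>\<^sup>2 * ?\<beta>\<^sup>2 * z) = z" using a' unfolding c by (simp_all add: field_simps power2_eq_square)
      then show ?thesis using ijk by (simp add: t matrix_3_def)
    qed
    have "bij_betw ?f (fixed_matrices a \<sigma>) ?T"
    proof (rule bij_betw_byWitness[of _ ?M])
      show "\<forall>A\<in>fixed_matrices a \<sigma>. ?M (?f A) = A" using M_f by blast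
      show "\<forall>t\<in>?T. ?f (?M t) = t" using f_M by blast
      show "?f ` fixed_matrices a \<sigma> \<subseteq> ?T"
      proof
        fix t assume "t \<in> ?f ` fixed_matrices a \<sigma>"
        then obtain A where A: "A \<in> fixed_matrices a \<sigma>" "t = ?f A" by blast
        then have "det (?M t) \<noteq> 0" using M_f fixed by simp
        then show "t \<in> ?T" using det_M unfolding A(2) by simp
      qed
      show "?M ` ?T \<subseteq> fixed_matrices a \<sigma>"
      proof
        fix B assume "B \<in> ?M ` ?T"
        then obtain x y z where B: "B = ?M (x, y, z)"
          and ne: "x ^ 3 + y ^ 3 + z ^ 3 - 3 * x * y * z \<noteq> 0" by blast
        have "det B \<noteq> 0" unfolding B det_M using ne a' by simp
        moreover have "x * ?\<alpha>\<^sup>2 = ?\<alpha> * (?\<alpha> * x)" "?\<alpha>\<^sup>2 * y * ?\<beta>\<^sup>2 = ?\<alpha> * (?\<alpha> * ?\<beta>\<^sup>2 * y)"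
          "?\<alpha>\<^sup>2 * ?\<beta>\<^sup>2 * z * ?\<gamma>\<^sup>2 = ?\<alpha> * (?\<beta> * ?\<gamma> * z)" "?\<beta> * ?\<gamma> * z * ?\<alpha>\<^sup>2 = ?\<beta> * (?\<alpha>\<^sup>2 * ?\<gamma> * z)"
          "?\<alpha> * x * ?\<beta>\<^sup>2 = ?\<beta> * (?\<alpha> * ?\<beta> * x)" "?\<alpha> * ?\<beta>\<^sup>2 * y * ?\<gamma>\<^sup>2 = ?\<beta> * (?\<gamma> * y)"
          "?\<gamma> * y * ?\<alpha>\<^sup>2 = ?\<gamma> * (?\<alpha>\<^sup>2 * y)" "?\<alpha>\<^sup>2 * ?\<gamma> * z * ?\<beta>\<^sup>2 = ?\<gamma> * (?\<alpha>\<^sup>2 * ?\<beta>\<^sup>2 * z)"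
          "?\<alpha> * ?\<beta> * x * ?\<gamma>\<^sup>2 = ?\<gamma> * x"
          using a' unfolding c by (simp_all add: field_simps power2_eq_square)
        moreover have "B$i$i = x" "B$i$j = ?\<alpha>\<^sup>2 * y" "B$i$k = ?\<alpha>\<^sup>2 * ?\<beta>\<^sup>2 * z"
          "B$j$i = ?\<beta> * ?\<gamma> * z" "B$j$j = ?\<alpha> * x" "B$j$k = ?\<alpha> * ?\<beta>\<^sup>2 * y"
          "B$k$i = ?\<gamma> * y" "B$k$j = ?\<alpha>\<^sup>2 * ?\<gamma> * z" "B$k$k = ?\<alpha> * ?\<beta> * x"
          using ijk by (simp_all add: B matrix_3_def)
        ultimately show "B \<in> fixed_matrices a \<sigma>" unfolding fixed by simp
      qed
    qed
    then show ?thesis using abg by (simp add: bij_betw_same_card)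
  qed
qed

lemma card_coefficients_cycle:
  fixes i j k :: 3
  assumes ijk: "i \<noteq> j" "i \<noteq> k" "j \<noteq> k"
  shows "real (card {a :: 3 \<Rightarrow> 'f::{field,finite}. (\<forall>r. a r \<noteq> 0) \<and> a i * a j * a k = 1}) = (real CARD('f) - 1) ^ 2"
proof -
  have "bij_betw (\<lambda>a. (a i, a j)) {a :: 3 \<Rightarrow> 'f. (\<forall>r. a r \<noteq> 0) \<and> a i * a j * a k = 1} ({x. x \<noteq> 0} \<times> {x. x \<noteq> 0})"
    by (rule bij_betw_byWitness[of _ "\<lambda>(x, y) r. if r = i then x else if r = j then y else 1 / (x * y)"])
       (use ijk in \<open>auto simp: fun_eq_iff all_indices_3[OF ijk] field_simps\<close>)
  then show ?thesis
    by (simp add: bij_betw_same_card real_card_nonzero card_cartesian_product power2_eq_square)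
qed

section \<open>Matrices fixed over the identity permutation\<close>

text \<open>
  The matrices whose nonzero entries are exactly those of the permutation matrix of \<open>\<pi>\<close>.
\<close>

definition support_matrices :: "('n \<Rightarrow> 'n) \<Rightarrow> ('f::zero ^ 'n ^ 'n) set" where
  "support_matrices \<pi> = {A. \<forall>r c. A $ r $ c \<noteq> 0 \<longleftrightarrow> r = \<pi> c}"

lemma card_support_matrices:
  "real (card (support_matrices \<pi> :: ('f::{field,finite} ^ 'n ^ 'n) set)) = (real CARD('f) - 1) ^ CARD('n)"
proof -
  have "bij_betw (\<lambda>A c. A $ \<pi> c $ c) (support_matrices \<pi>) {a :: 'n \<Rightarrow> 'f. \<forall>i. a i \<noteq> 0}"
    by (rule bij_betw_byWitness[of _ "\<lambda>a. \<chi> r c. if r = \<pi> c then a c else 0"])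
       (auto simp: support_matrices_def vec_eq_iff split: if_splits)
  then show ?thesis by (simp add: bij_betw_same_card card_nonvanishing_functions)
qed

lemma det_support_matrix:
  fixes A :: "'f::field ^ 3 ^ 3"
  assumes A: "A \<in> support_matrices \<pi>" and \<pi>: "bij \<pi>"
  shows "det A \<noteq> 0"
proof -
  have s: "A $ r $ c \<noteq> 0 \<longleftrightarrow> r = \<pi> c" for r c using A by (simp add: support_matrices_def)
  have s0: "A $ r $ c = 0 \<longleftrightarrow> r \<noteq> \<pi> c" for r c using s by blast
  from \<pi> show ?thesis
  proof (cases rule: permutation_3_cases)
    case identity
    then have "A $ r $ c = 0" if "r \<noteq> c" for r c using that s0 by simp
    then show ?thesis using s identity by (simp add: det_3)
  next
    case (transposition i j k)
    then have "\<pi> i = j" "\<pi> j = i" "\<pi> k = k" by (auto simp: Transposition.transpose_def)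
    then show ?thesis
      using s0[of i i] s0[of j j] s0[of i j] s0[of j i] s0[of i k] s0[of j k] s0[of k i] s0[of k j] s0[of k k] transposition
      by (simp add: det_indices_3[OF transposition(1-3)])
  next
    case (cycle i j k)
    then show ?thesis
      using s0[of i i] s0[of j j] s0[of i j] s0[of j i] s0[of i k] s0[of j k] s0[of k i] s0[of k j] s0[of k k]
      by (simp add: det_indices_3[OF cycle(1-3)])
  qed
qed

text \<open>
  Some term of the Leibniz expansion is nonzero.
\<close>

lemma det_nonzero_imp_permutation:
  fixes A :: "'f::field ^ 'n ^ 'n"
  assumes "det A \<noteq> 0"
  obtains \<pi> where "bij \<pi>" "\<And>c. A $ \<pi> c $ c \<noteq> 0"
proof -
  have "\<exists>p\<in>{p. p permutes UNIV}. of_int (sign p) * (\<Prod>i\<in>UNIV. A $ i $ p i) \<noteq> 0"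
    using assms unfolding det_def by (meson sum.not_neutral_contains_not_neutral)
  then obtain p where p: "p permutes UNIV" and ne: "(\<Prod>i\<in>UNIV. A $ i $ p i) \<noteq> 0" by auto
  have bp: "bij p" using p by (rule permutes_bij)
  have nz: "A $ i $ p i \<noteq> 0" for i using ne by simp
  show thesis
  proof (rule that[of "inv_into UNIV p"])
    show "bij (inv_into UNIV p)" using bp by (rule bij_imp_bij_inv)
    show "A $ inv_into UNIV p c $ c \<noteq> 0" for c
      using nz[of "inv_into UNIV p c"] bp by (simp add: bij_is_surj surj_f_inv_f)
  qed
qed

text \<open>
  If squaring permutes the coefficients along a transposition, they are \<open>w\<close>, \<open>w\<^sup>2\<close>, 1 with
  \<open>w\<^sup>3 = 1\<close>; along a three-cycle they are \<open>w\<close>, \<open>w\<^sup>2\<close>, \<open>w\<^sup>4\<close> with \<open>w\<^sup>7 = 1\<close>. Excluding \<open>w = 1\<close>,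
  the values are distinct.
\<close>

lemma squaring_permutation_inj:
  fixes a :: "3 \<Rightarrow> 'f::field"
  assumes nz: "\<And>r. a r \<noteq> 0" and ne: "a \<noteq> (\<lambda>_. 1)" and \<pi>: "bij \<pi>" and sq: "\<And>c. a (\<pi> c) = (a c)\<^sup>2"
  shows "inj a"
proof -
  have one: "x = 1" if "x = x\<^sup>2" "x \<noteq> 0" for x :: 'f using that by (simp add: power2_eq_square)
  have inj: "inj a" if ijk: "i \<noteq> j" "i \<noteq> k" "j \<noteq> k" and "a i \<noteq> a j" "a i \<noteq> a k" "a j \<noteq> a k" for i j k
  proof (rule injI)
    fix r s assume "a r = a s"
    then show "r = s"
      using that distinct_indices_3[OF ijk, of r] distinct_indices_3[OF ijk, of s] by auto
  qed
  from \<pi> show ?thesis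
  proof (cases rule: permutation_3_cases)
    case identity
    then have "a c = 1" for c using one[OF _ nz] sq by simp
    then show ?thesis using ne by (simp add: fun_eq_iff)
  next
    case (transposition i j k)
    then have s: "a j = (a i)\<^sup>2" "a i = (a j)\<^sup>2" "a k = (a k)\<^sup>2"
      using sq[of i] sq[of j] sq[of k] by (auto simp: Transposition.transpose_def)
    have k: "a k = 1" by (rule one[OF s(3) nz])
    have i: "a i \<noteq> 1"
    proof
      assume i: "a i = 1"
      then have "a j = 1" using s(1) by simp
      then have "\<forall>r. a r = 1" unfolding all_indices_3[OF transposition(1-3)] using i k by simp
      then show False using ne by (simp add: fun_eq_iff)
    qed
    then have j: "a j \<noteq> 1" using s(2) by auto
    have "a i \<noteq> a j"
    proof
      assume "a i = a j"
      then have "a i = (a i)\<^sup>2" using s(1) by simp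
      then show False using one[OF _ nz] i by blast
    qed
    then show ?thesis using inj[OF transposition(1-3)] i j k by simp
  next
    case (cycle i j k)
    then have s: "a j = (a i)\<^sup>2" "a k = (a j)\<^sup>2" "a i = (a k)\<^sup>2"
      using sq[of i] sq[of j] sq[of k] by auto
    have ne1: "a i \<noteq> 1 \<and> a j \<noteq> 1 \<and> a k \<noteq> 1"
    proof (rule ccontr)
      assume "\<not> ?thesis"
      moreover have "a i = 1 \<Longrightarrow> a j = 1" using s(1) by simp
      moreover have "a j = 1 \<Longrightarrow> a k = 1" using s(2) by simp
      moreover have "a k = 1 \<Longrightarrow> a i = 1" using s(3) by simp
      ultimately have "a i = 1 \<and> a j = 1 \<and> a k = 1" by blast
      then have "\<forall>r. a r = 1" unfolding all_indices_3[OF cycle(1-3)] .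
      then show False using ne by (simp add: fun_eq_iff)
    qed
    have "a i \<noteq> (a i)\<^sup>2" "a j \<noteq> (a j)\<^sup>2" "a k \<noteq> (a k)\<^sup>2"
      using ne1 one[OF _ nz] by blast+
    then have "a i \<noteq> a j" "a j \<noteq> a k" "a k \<noteq> a i" unfolding s[symmetric] .
    then show ?thesis using inj[OF cycle(1-3)] by auto
  qed
qed

text \<open>
  A diagonal transformation fixes \<open>A\<close> if and only if \<open>a\<^sub>r = a\<^sub>c\<^sup>2\<close> at every nonzero entry \<open>(r, c)\<close>. A nonsingular \<open>A\<close> has
  nonzero entries along some permutation \<open>\<pi>\<close>, so squaring permutes the coefficients by \<open>\<pi>\<close>; by
  injectivity of \<open>a\<close> there are no other nonzero entries. Distinct \<open>\<pi>\<close> give disjoint sets of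
  matrices.
\<close>

lemma card_fixed_matrices_id:
  fixes a :: "3 \<Rightarrow> 'f::{field,finite}"
  assumes nz: "\<And>r. a r \<noteq> 0" and ne: "a \<noteq> (\<lambda>_. 1)"
  shows "real (card (fixed_matrices a id)) =
    (\<Sum>\<pi> | bij \<pi>. if \<forall>c. a (\<pi> c) = (a c)\<^sup>2 then (real CARD('f) - 1) ^ 3 else 0)"
proof -
  let ?V = "{\<pi> :: 3 \<Rightarrow> 3. bij \<pi> \<and> (\<forall>c. a (\<pi> c) = (a c)\<^sup>2)}"
  have "fixed_matrices a id = (\<Union>\<pi>\<in>?V. support_matrices \<pi>)"
  proof (intro equalityI subsetI)
    fix A assume A: "A \<in> fixed_matrices a id"
    then have "det A \<noteq> 0" and eqs: "A $ r $ c * (a c)\<^sup>2 = a r * A $ r $ c" for r c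
      by (auto simp: fixed_matrices_def)
    then obtain \<pi> where \<pi>: "bij \<pi>" "\<And>c. A $ \<pi> c $ c \<noteq> 0"
      by (elim det_nonzero_imp_permutation) blast
    have eq: "a r = (a c)\<^sup>2" if "A $ r $ c \<noteq> 0" for r c using eqs[of r c] that by simp
    then have sq: "a (\<pi> c) = (a c)\<^sup>2" for c using \<pi>(2) by blast
    have "r = \<pi> c" if "A $ r $ c \<noteq> 0" for r c
    proof (rule injD[OF squaring_permutation_inj[OF nz ne \<pi>(1) sq]])
      show "a r = a (\<pi> c)" unfolding sq by (rule eq[OF that])
    qed
    then have "A \<in> support_matrices \<pi>" using \<pi>(2) by (auto simp: support_matrices_def)
    then show "A \<in> (\<Union>\<pi>\<in>?V. support_matrices \<pi>)" using \<pi>(1) sq by blast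
  next
    fix A :: "'f ^ 3 ^ 3" assume "A \<in> (\<Union>\<pi>\<in>?V. support_matrices \<pi>)"
    then obtain \<pi> where \<pi>: "bij \<pi>" "\<And>c. a (\<pi> c) = (a c)\<^sup>2" and A: "A \<in> support_matrices \<pi>" by blast
    have "A $ r $ c * (a c)\<^sup>2 = a r * A $ r $ c" for r c
      using A \<pi>(2)[of c] by (cases "r = \<pi> c") (auto simp: support_matrices_def mult.commute)
    then show "A \<in> fixed_matrices a id" using det_support_matrix[OF A \<pi>(1)] by (simp add: fixed_matrices_def)
  qed
  moreover have "card (\<Union>\<pi>\<in>?V. support_matrices \<pi> :: ('f ^ 3 ^ 3) set) = (\<Sum>\<pi>\<in>?V. card (support_matrices \<pi> :: ('f ^ 3 ^ 3) set))"
  proof (rule card_UN_disjoint)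
    show "\<forall>\<pi>\<in>?V. \<forall>\<rho>\<in>?V. \<pi> \<noteq> \<rho> \<longrightarrow> support_matrices \<pi> \<inter> support_matrices \<rho> = ({} :: ('f ^ 3 ^ 3) set)"
    proof (intro ballI impI)
      fix \<pi> \<rho> :: "3 \<Rightarrow> 3" assume "\<pi> \<noteq> \<rho>"
      then obtain c where c: "\<pi> c \<noteq> \<rho> c" by (auto simp: fun_eq_iff)
      have "A $ \<pi> c $ c \<noteq> 0 \<and> A $ \<pi> c $ c = 0" if "A \<in> support_matrices \<pi> \<inter> support_matrices \<rho>" for A :: "'f ^ 3 ^ 3"
        using that c by (auto simp: support_matrices_def)
      then show "support_matrices \<pi> \<inter> support_matrices \<rho> = ({} :: ('f ^ 3 ^ 3) set)" by blast
    qed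
  qed auto
  ultimately have "real (card (fixed_matrices a id)) = (\<Sum>\<pi>\<in>?V. (real CARD('f) - 1) ^ 3)"
    by (simp add: card_support_matrices)
  also have "\<dots> = (\<Sum>\<pi> | bij \<pi>. if \<forall>c. a (\<pi> c) = (a c)\<^sup>2 then (real CARD('f) - 1) ^ 3 else 0)"
    by (subst sum.inter_filter[symmetric]) auto
  finally show ?thesis .
qed

lemma card_squaring_coefficients_transposition:
  fixes i j k :: 3
  assumes ijk: "i \<noteq> j" "i \<noteq> k" "j \<noteq> k"
  shows "card {a :: 3 \<Rightarrow> 'f::{field,finite}. ((\<forall>r. a r \<noteq> 0) \<and> a \<noteq> (\<lambda>_. 1)) \<and> (\<forall>c. a (Transposition.transpose i j c) = (a c)\<^sup>2)} =
    card {w :: 'f. w ^ 3 = 1 \<and> w \<noteq> 1}"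
proof -
  have t: "Transposition.transpose i j i = j" "Transposition.transpose i j j = i" "Transposition.transpose i j k = k"
    using ijk by (auto simp: Transposition.transpose_def)
  let ?a = "\<lambda>(w :: 'f) r. if r = i then w else if r = j then w\<^sup>2 else 1"
  let ?S = "{a :: 3 \<Rightarrow> 'f. ((\<forall>r. a r \<noteq> 0) \<and> a \<noteq> (\<lambda>_. 1)) \<and> (\<forall>c. a (Transposition.transpose i j c) = (a c)\<^sup>2)}"
  let ?W = "{w :: 'f. w ^ 3 = 1 \<and> w \<noteq> 1}"
  have S: "a i ^ 3 = 1 \<and> a i \<noteq> 1 \<and> ?a (a i) = a" if "a \<in> ?S" for a
  proof -
    from that have nz: "a r \<noteq> 0" and ne: "a \<noteq> (\<lambda>_. 1)" and sq: "\<forall>c. a (Transposition.transpose i j c) = (a c)\<^sup>2" for r by auto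
    from sq have s: "a j = (a i)\<^sup>2" "a i = (a j)\<^sup>2" "a k = (a k)\<^sup>2" unfolding all_indices_3[OF ijk] t by blast+
    have k: "a k = 1" using s(3) nz[of k] by (simp add: power2_eq_square)
    have eq: "?a (a i) = a"
      using ijk s(1) k all_indices_3[OF ijk, of "\<lambda>r. ?a (a i) r = a r"] by (simp add: fun_eq_iff)
    have "a i * 1 = a i * a i ^ 3"
      using s(2) unfolding s(1) by (simp add: power2_eq_square power3_eq_cube mult.assoc)
    then have "a i ^ 3 = 1" using nz[of i] by simp
    moreover have "a i \<noteq> 1"
    proof
      assume "a i = 1"
      then have "?a (a i) = (\<lambda>_. 1)" by (simp add: fun_eq_iff)
      then show False using ne unfolding eq by blast
    qed
    ultimately show ?thesis using eq by blast
  qed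
  have W: "?a w \<in> ?S" if "w \<in> ?W" for w
  proof -
    have w: "w * w\<^sup>2 = 1" "w \<noteq> 1" using that by (simp_all add: power2_eq_square power3_eq_cube mult.assoc)
    then have w0: "w \<noteq> 0" by auto
    have "(w\<^sup>2)\<^sup>2 = w * (w * w\<^sup>2)" by (simp add: power2_eq_square)
    then have "(w\<^sup>2)\<^sup>2 = w" using w by simp
    moreover have "?a w \<noteq> (\<lambda>_. 1)" using w by (auto simp: fun_eq_iff)
    ultimately show ?thesis using ijk w0 by (simp add: all_indices_3[OF ijk] t)
  qed
  have "bij_betw (\<lambda>a. a i) ?S ?W"
  proof (rule bij_betw_byWitness[of _ ?a])
    show "\<forall>a\<in>?S. ?a (a i) = a" using S by blast
    show "(\<lambda>a. a i) ` ?S \<subseteq> ?W" by (rule image_subsetI, drule S, simp)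
    show "?a ` ?W \<subseteq> ?S" by (rule image_subsetI, erule W)
  qed simp
  then show ?thesis by (rule bij_betw_same_card)
qed

lemma card_squaring_coefficients_cycle:
  fixes i j k :: 3
  assumes ijk: "i \<noteq> j" "i \<noteq> k" "j \<noteq> k" and \<sigma>: "\<sigma> i = j" "\<sigma> j = k" "\<sigma> k = i"
  shows "card {a :: 3 \<Rightarrow> 'f::{field,finite}. ((\<forall>r. a r \<noteq> 0) \<and> a \<noteq> (\<lambda>_. 1)) \<and> (\<forall>c. a (\<sigma> c) = (a c)\<^sup>2)} =
    card {w :: 'f. w ^ 7 = 1 \<and> w \<noteq> 1}"
proof -
  let ?a = "\<lambda>(w :: 'f) r. if r = i then w else if r = j then w\<^sup>2 else w ^ 4"
  let ?S = "{a :: 3 \<Rightarrow> 'f. ((\<forall>r. a r \<noteq> 0) \<and> a \<noteq> (\<lambda>_. 1)) \<and> (\<forall>c. a (\<sigma> c) = (a c)\<^sup>2)}"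
  let ?W = "{w :: 'f. w ^ 7 = 1 \<and> w \<noteq> 1}"
  have S: "a i ^ 7 = 1 \<and> a i \<noteq> 1 \<and> ?a (a i) = a" if "a \<in> ?S" for a
  proof -
    from that have nz: "a r \<noteq> 0" and ne: "a \<noteq> (\<lambda>_. 1)" and sq: "\<forall>c. a (\<sigma> c) = (a c)\<^sup>2" for r by auto
    from sq have s: "a j = (a i)\<^sup>2" "a k = (a j)\<^sup>2" "a i = (a k)\<^sup>2" unfolding all_indices_3[OF ijk] \<sigma> by blast+
    have k: "a k = a i ^ 4" unfolding s(2) s(1) by (simp flip: power_mult)
    have eq: "?a (a i) = a"
      using ijk s(1) k all_indices_3[OF ijk, of "\<lambda>r. ?a (a i) r = a r"] by (simp add: fun_eq_iff)
    have "a i = a i ^ 8" using s(3) unfolding k by (simp flip: power_mult)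
    also have "\<dots> = a i * a i ^ 7" by (simp flip: power_Suc)
    finally have "a i ^ 7 = 1" using nz[of i] by simp
    moreover have "a i \<noteq> 1"
    proof
      assume "a i = 1"
      then have "?a (a i) = (\<lambda>_. 1)" by (simp add: fun_eq_iff)
      then show False using ne unfolding eq by blast
    qed
    ultimately show ?thesis using eq by blast
  qed
  have W: "?a w \<in> ?S" if "w \<in> ?W" for w
  proof -
    have w: "w ^ 7 = 1" "w \<noteq> 1" using that by simp_all
    then have w0: "w \<noteq> 0" by auto
    have "(w\<^sup>2)\<^sup>2 = w ^ 4" by (simp flip: power_mult)
    moreover have "(w ^ 4)\<^sup>2 = w * w ^ 7" by (simp flip: power_mult power_Suc)
    then have "(w ^ 4)\<^sup>2 = w" using w by simp
    moreover have "?a w \<noteq> (\<lambda>_. 1)" using w by (auto simp: fun_eq_iff)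
    ultimately show ?thesis using ijk w0 by (simp add: all_indices_3[OF ijk] \<sigma>)
  qed
  have "bij_betw (\<lambda>a. a i) ?S ?W"
  proof (rule bij_betw_byWitness[of _ ?a])
    show "\<forall>a\<in>?S. ?a (a i) = a" using S by blast
    show "(\<lambda>a. a i) ` ?S \<subseteq> ?W" by (rule image_subsetI, drule S, simp)
    show "?a ` ?W \<subseteq> ?S" by (rule image_subsetI, erule W)
  qed simp
  then show ?thesis by (rule bij_betw_same_card)
qed

lemma sum_indicator:
  fixes S :: "'a::finite set"
  shows "(\<Sum>x\<in>S. if P x then t else 0) = real (card {x \<in> S. P x}) * t"
  by (subst sum.inter_filter[symmetric]) auto

text \<open>
  The trivial element fixes all nonsingular matrices. For the other diagonal elements, the sum over \<open>a\<close> is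
  exchanged with the one over the permutation \<open>\<pi>\<close> that supports the matrix; this is how roots of unity of order 3 and 7
  enter the count.
\<close>

lemma sum_fixed_matrices_id:
  "(\<Sum>a | \<forall>r. a r \<noteq> (0 :: 'f::{field,finite}). real (card (fixed_matrices a (id :: 3 \<Rightarrow> 3)))) =
   real (card {A :: 'f ^ 3 ^ 3. det A \<noteq> 0}) +
   (real CARD('f) - 1) ^ 3 * (3 * real (card {w :: 'f. w ^ 3 = 1 \<and> w \<noteq> 1}) + 2 * real (card {w :: 'f. w ^ 7 = 1 \<and> w \<noteq> 1}))"
proof -
  let ?N = "{a :: 3 \<Rightarrow> 'f. (\<forall>r. a r \<noteq> 0) \<and> a \<noteq> (\<lambda>_. 1)}"
  let ?t = "(real CARD('f) - 1) ^ 3"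
  have split: "{a :: 3 \<Rightarrow> 'f. \<forall>r. a r \<noteq> 0} = insert (\<lambda>_. 1) ?N" by auto
  have one: "fixed_matrices (\<lambda>_. 1) (id :: 3 \<Rightarrow> 3) = {A :: 'f ^ 3 ^ 3. det A \<noteq> 0}"
    by (auto simp: fixed_matrices_def)
  have "(\<Sum>a\<in>?N. real (card (fixed_matrices a id))) =
      (\<Sum>a\<in>?N. \<Sum>\<pi> | bij \<pi>. if \<forall>c. a (\<pi> c) = (a c)\<^sup>2 then ?t else 0)"
    by (intro sum.cong refl card_fixed_matrices_id) auto
  also have "\<dots> = (\<Sum>\<pi> | bij \<pi>. \<Sum>a\<in>?N. if \<forall>c. a (\<pi> c) = (a c)\<^sup>2 then ?t else 0)"
    by (rule sum.swap)
  also have "\<dots> = 0 + 3 * (real (card {w :: 'f. w ^ 3 = 1 \<and> w \<noteq> 1}) * ?t) + 2 * (real (card {w :: 'f. w ^ 7 = 1 \<and> w \<noteq> 1}) * ?t)"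
  proof (rule sum_permutations_3, goal_cases)
    case 1
    have "a = (\<lambda>_. 1)" if "\<forall>r. a r \<noteq> 0" "\<forall>c. a c = (a c)\<^sup>2" for a :: "3 \<Rightarrow> 'f"
    proof
      fix c show "a c = 1" using that(1) spec[OF that(2), of c] by (simp add: power2_eq_square)
    qed
    then have "{a \<in> ?N. \<forall>c. a (id c) = (a c)\<^sup>2} = {}" by auto
    then show ?case unfolding sum_indicator by simp
  next
    case (2 i j k)
    then show ?case unfolding sum_indicator mem_Collect_eq by (simp only: card_squaring_coefficients_transposition[OF 2])
  next
    case (3 i j k \<sigma>)
    then show ?case unfolding sum_indicator mem_Collect_eq by (simp only: card_squaring_coefficients_cycle[OF 3])
  qed
  finally have N: "(\<Sum>a\<in>?N. real (card (fixed_matrices a id))) = \<dots>" .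
  have "(\<Sum>a | \<forall>r :: 3. a r \<noteq> (0 :: 'f). real (card (fixed_matrices a (id :: 3 \<Rightarrow> 3)))) =
      real (card (fixed_matrices (\<lambda>_. 1 :: 'f) (id :: 3 \<Rightarrow> 3))) + (\<Sum>a\<in>?N. real (card (fixed_matrices a id)))"
    unfolding split by (rule sum.insert) auto
  then show ?thesis unfolding N one by (simp add: algebra_simps)
qed

section \<open>The number of isomorphism classes\<close>

lemma burnside_count:
  "6 * (real CARD('f) - 1) ^ 3 * real (num_idempotent_evolution_algebras TYPE(3) TYPE('f::{field,finite})) =
   real (card {A :: 'f ^ 3 ^ 3. det A \<noteq> 0}) +
   (real CARD('f) - 1) ^ 3 * (3 * real (card {w :: 'f. w ^ 3 = 1 \<and> w \<noteq> 1}) + 2 * real (card {w :: 'f. w ^ 7 = 1 \<and> w \<noteq> 1})) +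
   3 * ((real CARD('f) - 1) * real (card {((x :: 'f, y), (u, v, z)). (x - y) * ((x + y) * z - 2 * u * v) \<noteq> 0})) +
   2 * ((real CARD('f) - 1) ^ 2 * real (card {(x :: 'f, y, z). x ^ 3 + y ^ 3 + z ^ 3 - 3 * x * y * z \<noteq> 0}))"
proof -
  let ?X = "{A :: 'f ^ 3 ^ 3. invertible A}"
  let ?act = "\<lambda>g. restrict (monomial_act g) ?X"
  let ?G = "monomial_group :: ((3 \<Rightarrow> 'f) \<times> (3 \<Rightarrow> 3)) monoid"
  interpret group_action ?G ?X ?act by (rule group_action_monomial)
  have carrier: "carrier ?G = {a. \<forall>r. a r \<noteq> 0} \<times> {\<sigma>. bij \<sigma>}" by (auto simp: carrier_monomial_group)
  have "(\<Sum>\<sigma> | bij (\<sigma> :: 3 \<Rightarrow> 3). 1) = (1 + 3 * 1 + 2 * 1 :: real)" by (rule sum_permutations_3) auto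
  then have "real (card {\<sigma> :: 3 \<Rightarrow> 3. bij \<sigma>}) = 6" by simp
  then have ord: "real (Coset.order ?G) = 6 * (real CARD('f) - 1) ^ 3"
    by (simp add: Coset.order_def carrier card_cartesian_product card_nonvanishing_functions)
  have "6 * (real CARD('f) - 1) ^ 3 * real (num_idempotent_evolution_algebras TYPE(3) TYPE('f)) =
      real (card (orbits ?G ?X ?act) * Coset.order ?G)"
    unfolding card_isomorphism_classes_eq_orbits of_nat_mult ord by simp
  also have "\<dots> = (\<Sum>g\<in>carrier ?G. real (card (invariants ?X ?act g)))"
    by (subst burnside) auto
  also have "\<dots> = (\<Sum>a | \<forall>r :: 3. a r \<noteq> (0 :: 'f). \<Sum>\<sigma> | bij \<sigma>. real (card (invariants ?X ?act (a, \<sigma>))))"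
    unfolding carrier by (simp add: sum.cartesian_product)
  also have "\<dots> = (\<Sum>a | \<forall>r :: 3. a r \<noteq> (0 :: 'f). \<Sum>\<sigma> | bij \<sigma>. real (card (fixed_matrices a \<sigma>)))"
    by (intro sum.cong refl) (simp add: invariants_eq_fixed_matrices)
  also have "\<dots> = (\<Sum>\<sigma> | bij \<sigma>. \<Sum>a | \<forall>r :: 3. a r \<noteq> (0 :: 'f). real (card (fixed_matrices a \<sigma>)))"
    by (rule sum.swap)
  also have "\<dots> = (real (card {A :: 'f ^ 3 ^ 3. det A \<noteq> 0}) +
   (real CARD('f) - 1) ^ 3 * (3 * real (card {w :: 'f. w ^ 3 = 1 \<and> w \<noteq> 1}) + 2 * real (card {w :: 'f. w ^ 7 = 1 \<and> w \<noteq> 1}))) +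
   3 * ((real CARD('f) - 1) * real (card {((x :: 'f, y), (u, v, z)). (x - y) * ((x + y) * z - 2 * u * v) \<noteq> 0})) +
   2 * ((real CARD('f) - 1) ^ 2 * real (card {(x :: 'f, y, z). x ^ 3 + y ^ 3 + z ^ 3 - 3 * x * y * z \<noteq> 0}))"
    (is "_ = _ + 3 * (_ * ?T) + 2 * (_ * ?C)")
  proof (rule sum_permutations_3, goal_cases)
    case 1
    show ?case by (rule sum_fixed_matrices_id)
  next
    case (2 i j k)
    have "(\<Sum>a | \<forall>r :: 3. a r \<noteq> (0 :: 'f). real (card (fixed_matrices a (Transposition.transpose i j)))) =
        (\<Sum>a | \<forall>r :: 3. a r \<noteq> (0 :: 'f). if a i * a j = 1 \<and> a k = 1 then ?T else 0)"
      by (intro sum.cong refl) (simp add: card_fixed_matrices_transposition[OF 2])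
    also have "\<dots> = (real CARD('f) - 1) * ?T"
      unfolding sum_indicator mem_Collect_eq by (simp only: card_coefficients_transposition[OF 2])
    finally show ?case .
  next
    case (3 i j k \<sigma>)
    have "(\<Sum>a | \<forall>r :: 3. a r \<noteq> (0 :: 'f). real (card (fixed_matrices a \<sigma>))) =
        (\<Sum>a | \<forall>r :: 3. a r \<noteq> (0 :: 'f). if a i * a j * a k = 1 then ?C else 0)"
      by (intro sum.cong refl) (simp add: card_fixed_matrices_cycle[OF 3])
    also have "\<dots> = (real CARD('f) - 1) ^ 2 * ?C"
      unfolding sum_indicator mem_Collect_eq by (simp only: card_coefficients_cycle[OF 3(1-3)])
    finally show ?case .
  qed
  finally show ?thesis by (simp only: add.assoc)
qed

text \<open>
  A form of the count without case distinction on \<open>p\<close>. Each of the four contributions in Burnside's formula is divisible by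
  \<open>(q - 1)\<^sup>3\<close>, a sixth of the order of the group.
\<close>

lemma isomorphism_class_count:
  fixes q :: real
  defines "q \<equiv> real CARD('f::{field,finite})"
  shows "6 * real (num_idempotent_evolution_algebras TYPE(3) TYPE('f)) =
    q ^ 3 * (q + 1) * (q ^ 2 + q + 1) +
    (if 3 dvd CARD('f) - 1 then 6 else 0) + (if 7 dvd CARD('f) - 1 then 12 else 0) +
    3 * (if (2 :: 'f) = 0 then q ^ 3 else q * (q ^ 2 - 1)) +
    2 * (if (3 :: 'f) = 0 then q ^ 2 else if 3 dvd CARD('f) - 1 then (q - 1) ^ 2 else q ^ 2 - 1)"
proof -
  let ?N = "real (num_idempotent_evolution_algebras TYPE(3) TYPE('f))"
  have "card {0, 1 :: 'f} \<le> CARD('f)" by (intro card_mono) auto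
  then have q: "q - 1 \<noteq> 0" by (simp add: q_def)
  have prime_7: "prime (7 :: nat)" by (simp add: prime_nat_numeral_eq)
  have R3: "real (card {w :: 'f. w ^ 3 = 1 \<and> w \<noteq> 1}) = (if 3 dvd CARD('f) - 1 then 2 else 0)"
    using card_nontrivial_roots_of_unity[of 3, where ?'f = 'f] by simp
  have R7: "real (card {w :: 'f. w ^ 7 = 1 \<and> w \<noteq> 1}) = (if 7 dvd CARD('f) - 1 then 6 else 0)"
    using card_nontrivial_roots_of_unity[OF prime_7, where ?'f = 'f] by simp
  \<comment> \<open>Expressing everything through \<open>d = q - 1\<close> exposes the common factor \<open>d\<^sup>3\<close>.\<close>
  define d where "d = q - 1"
  have qd: "q = d + 1" and d: "d \<noteq> 0" using q by (simp_all add: d_def)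
  have G: "(q ^ 3 - 1) * (q ^ 3 - q) * ((q - 1) * q ^ 2) = d ^ 3 * (q ^ 3 * (q + 1) * (q ^ 2 + q + 1))"
    unfolding d_def by (simp add: power2_eq_square power3_eq_cube algebra_simps)
  define t where "t = (if (2 :: 'f) = 0 then q ^ 3 else q * (q ^ 2 - 1))"
  have T: "(if (2 :: 'f) = 0 then q ^ 3 * (q - 1) ^ 2 else (q - 1) * ((q ^ 2 - 1) * ((q - 1) * q))) = d ^ 2 * t"
    unfolding d_def t_def by (simp add: power2_eq_square)
  define c where "c = (if (3 :: 'f) = 0 then q ^ 2 else if 3 dvd CARD('f) - 1 then (q - 1) ^ 2 else q ^ 2 - 1)"
  have C: "(if (3 :: 'f) = 0 then (q - 1) * q ^ 2 else (q - 1) * (q ^ 2 - 1 - (q - 1) * (if 3 dvd CARD('f) - 1 then 2 else 0))) = d * c"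
    unfolding d_def c_def by (simp add: power2_eq_square algebra_simps)
  define r where "r = 3 * (if 3 dvd CARD('f) - 1 then 2 else 0) + 2 * (if 7 dvd CARD('f) - 1 then 6 else (0 :: real))"
  have "6 * d ^ 3 * ?N = d ^ 3 * (q ^ 3 * (q + 1) * (q ^ 2 + q + 1)) + d ^ 3 * r + 3 * (d * (d ^ 2 * t)) + 2 * (d ^ 2 * (d * c))"
    using burnside_count[where ?'f = 'f]
    unfolding card_nonsingular_3 card_swap_invariant card_circulant R3 R7
    unfolding q_def[symmetric] G T C unfolding d_def r_def .
  also have "\<dots> = d ^ 3 * (q ^ 3 * (q + 1) * (q ^ 2 + q + 1) + r + 3 * t + 2 * c)"
    by (simp add: power2_eq_square power3_eq_cube algebra_simps)
  finally have "d ^ 3 * (6 * ?N) = d ^ 3 * (q ^ 3 * (q + 1) * (q ^ 2 + q + 1) + r + 3 * t + 2 * c)" by (simp only: mult_ac)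
  then have "6 * ?N = q ^ 3 * (q + 1) * (q ^ 2 + q + 1) + r + 3 * t + 2 * c" using d by simp
  then show ?thesis unfolding r_def t_def c_def by simp
qed

theorem theorem5p1:
  fixes p m q :: nat and c N :: real
  assumes "prime p"
    and "q = p ^ m"
    and "CARD('f::{field,finite}) = q"
    and "c = real q ^ 3 * (real q + 1) * (real q ^ 2 + real q + 1) / 6"
    and "N = real (num_idempotent_evolution_algebras TYPE(3) TYPE('f))"
  shows
    "(p = 2 \<longrightarrow>
        (7 dvd (q - 1) \<and> 3 dvd (q - 1) \<longrightarrow>
           N = c + 3 + real q ^ 3 / 2 + (real q - 1) ^ 2 / 3) \<and>
        (7 dvd (q - 1) \<and> \<not> 3 dvd (q - 1) \<longrightarrow>
           N = c + 2 + real q ^ 3 / 2 + (real q ^ 2 - 1) / 3) \<and>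
        (\<not> 7 dvd (q - 1) \<and> 3 dvd (q - 1) \<longrightarrow>
           N = c + 1 + real q ^ 3 / 2 + (real q - 1) ^ 2 / 3) \<and>
        (\<not> 7 dvd (q - 1) \<and> \<not> 3 dvd (q - 1) \<longrightarrow>
           N = c + real q ^ 3 / 2 + (real q ^ 2 - 1) / 3)) \<and>
     (p = 3 \<longrightarrow>
        (7 dvd (q - 1) \<longrightarrow>
           N = c + 2 + real q * (real q ^ 2 - 1) / 2 + real q ^ 2 / 3) \<and>
        (\<not> 7 dvd (q - 1) \<longrightarrow>
           N = c + real q * (real q ^ 2 - 1) / 2 + real q ^ 2 / 3)) \<and>
     (p > 3 \<longrightarrow>
        (7 dvd (q - 1) \<and> 3 dvd (q - 1) \<longrightarrow>
           N = c + 3 + real q * (real q ^ 2 - 1) / 2 + (real q - 1) ^ 2 / 3) \<and>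
        (7 dvd (q - 1) \<and> \<not> 3 dvd (q - 1) \<longrightarrow>
           N = c + 2 + real q * (real q ^ 2 - 1) / 2 + (real q ^ 2 - 1) / 3) \<and>
        (\<not> 7 dvd (q - 1) \<and> 3 dvd (q - 1) \<longrightarrow>
           N = c + 1 + real q * (real q ^ 2 - 1) / 2 + (real q - 1) ^ 2 / 3) \<and>
        (\<not> 7 dvd (q - 1) \<and> \<not> 3 dvd (q - 1) \<longrightarrow>
           N = c + real q * (real q ^ 2 - 1) / 2 + (real q ^ 2 - 1) / 3))"
proof -
  have q: "real CARD('f) = real q" using assms(3) by simp
  have N: "N = (real q ^ 3 * (real q + 1) * (real q ^ 2 + real q + 1) +
    (if 3 dvd q - 1 then 6 else 0) + (if 7 dvd q - 1 then 12 else 0) +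
    3 * (if (2 :: 'f) = 0 then real q ^ 3 else real q * (real q ^ 2 - 1)) +
    2 * (if (3 :: 'f) = 0 then real q ^ 2 else if 3 dvd q - 1 then (real q - 1) ^ 2 else real q ^ 2 - 1)) / 6"
    using isomorphism_class_count[where ?'f = 'f] assms(5) unfolding assms(3) by simp
  have two: "(2 :: 'f) = 0 \<longleftrightarrow> p = 2" and three: "(3 :: 'f) = 0 \<longleftrightarrow> p = 3"
    using of_nat_prime_eq_0_iff[of p 2 m, where ?'f = 'f] of_nat_prime_eq_0_iff[of p 3 m, where ?'f = 'f] assms(1-3)
    by auto
  \<comment> \<open>A power of 3 exceeds a multiple of 3 by 1 only if it is 1, which is not the size of a field.\<close>
  have "\<not> 3 dvd q - 1" if "p = 3"
  proof
    assume dvd: "3 dvd q - 1"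
    have "card {0, 1 :: 'f} \<le> CARD('f)" by (intro card_mono) auto
    then have q2: "2 \<le> q" using assms(3) by simp
    then have "m \<noteq> 0" using assms(2) by (cases m) auto
    then have "3 dvd q" using assms(2) that by (simp add: dvd_power)
    then have "3 dvd q - (q - 1)" using dvd by (rule dvd_diff_nat)
    then show False using q2 by simp
  qed
  then show ?thesis
    unfolding N assms(4) two three by (auto simp: field_simps)
qed

end
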